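(* Let $\alpha\in(0,3)$ and $c_\delta\in(0,\infty)$. Let $N_{\alpha,c_\delta}=\sum_{i=1}^\infty\delta_{\xi_i}$ be a Poisson point process on $(0,2]$ with intensity measure $\nu_{\alpha,c_\delta}$ and atoms $(\xi_i)_{i\ge1}$. Then the random variable $$\sum_{i=1}^\infty\xi_i-c_\delta^2$$ has law $\eta_{\alpha,c_\delta}$. Moreover, this random variable can be written as $$\sum_{i=1}^\infty\xi_i-c_\delta^2=\int_{(0,2]}x\,\widehat N_{\alpha,c_\delta}(dx),$$ where $\widehat N_{\alpha,c_\delta}:=N_{\alpha,c_\delta}-\nu_{\alpha,c_\delta}$ is a compensated Poisson process.
   Context: For integers $m\ge2$, $$c_m(\alpha)=\begin{cases}\dfrac{\Gamma(m-\alpha/2)}{\Gamma(1-\alpha/2)\Gamma(m)},&\alpha\in(0,2),\\[2mm]\dfrac{\Gamma(1+\alpha/2)\Gamma(m-\alpha/2)}{\Gamma(m)},&\alpha\in[2,4).\end{cases}$$ The law $\eta_{\alpha,c_\delta}$ is the unique probability law on $\mathbb R$ with moments $$M_s=\sum_{v=1}^{\lfloor s/2\rfloor}c_\delta^{2v}\,\frac{2^{s-v}}{v!}\sum_{\substack{m_1,\ldots,m_v\ge2\\ m_1+\cdots+m_v=s}}\frac{s!}{m_1!\cdots m_v!}\prod_{\ell=1}^v c_{m_\ell}(\alpha)^2,\qquad s\ge1$$ (inner sum over ordered tuples of integers; empty sums are $0$). For $\alpha\in(0,2)$ let $\mu$ be the law of $2W$, where $W$ is the product of two independent $\mathrm{Beta}(1-\alpha/2,\alpha/2)$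 variables; for $\alpha\in[2,3)$ let $\mu'$ be the law of $2W'$, where $W'$ is the product of two independent $\mathrm{Beta}(2-\alpha/2,\alpha/2)$ variables. The measure $\nu_{\alpha,c_\delta}$ on $(0,2]$ is $$\nu_{\alpha,c_\delta}(dx)=\begin{cases}\dfrac{c_\delta^2}{x}\,\mu(dx),&\alpha\in(0,2),\\[2mm]\dfrac{2c_\delta^2c_2(\alpha)^2}{x^2}\,\mu'(dx),&\alpha\in[2,3).\end{cases}$$
   Formalization: For α in [2,3) the sum of the atoms is almost surely infinite, so there only the compensated integral (an L² limit of truncations) is shown to exist and have law η; convergence of the sum, its law after subtracting c_δ² and the identity with the integral are stated for α<2. *)

theory Defs
  imports "HOL-Probability.Probability"
begin

definition c_coeff :: "real \<Rightarrow> nat \<Rightarrow> real" where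
  "c_coeff \<alpha> m =
     (if \<alpha> < 2 then Gamma (real m - \<alpha> / 2) / (Gamma (1 - \<alpha> / 2) * Gamma (real m))
      else Gamma (1 + \<alpha> / 2) * Gamma (real m - \<alpha> / 2) / Gamma (real m))"

text \<open>Ordered tuples $(m_1,\dots,m_v)$ of integers $\ge 2$ with sum \<open>s\<close>, as lists.\<close>

definition tuples_ge2 :: "nat \<Rightarrow> nat \<Rightarrow> nat list set" where
  "tuples_ge2 v s = {m. length m = v \<and> (\<forall>k\<in>set m. 2 \<le> k) \<and> sum_list m = s}"

definition eta_moment :: "real \<Rightarrow> real \<Rightarrow> nat \<Rightarrow> real" where
  "eta_moment \<alpha> c s =
     (\<Sum>v = 1..s div 2. c ^ (2 * v) * (2 ^ (s - v) / fact v) *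
        (\<Sum>m\<in>tuples_ge2 v s.
           fact s / (\<Prod>l<v. fact (m ! l)) * (\<Prod>l<v. (c_coeff \<alpha> (m ! l))\<^sup>2)))"

definition has_eta_moments :: "real \<Rightarrow> real \<Rightarrow> real measure \<Rightarrow> bool" where
  "has_eta_moments \<alpha> c \<mu> \<longleftrightarrow>
     prob_space \<mu> \<and> sets \<mu> = sets borel \<and>
     (\<forall>s\<ge>1. integrable \<mu> (\<lambda>x. x ^ s) \<and> (LINT x|\<mu>. x ^ s) = eta_moment \<alpha> c s)"

definition eta :: "real \<Rightarrow> real \<Rightarrow> real measure" where
  "eta \<alpha> c = (THE \<mu>. has_eta_moments \<alpha> c \<mu>)"

definition beta_law :: "real \<Rightarrow> real \<Rightarrow> real measure" where
  "beta_law a b =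
     density lborel
       (\<lambda>x. ennreal (indicator {0<..<1} x * (x powr (a - 1) * (1 - x) powr (b - 1) / Beta a b)))"

text \<open>The law of \<open>2 * W\<close>, where \<open>W\<close> is the product of two independent
  $\mathrm{Beta}(a,b)$ variables.\<close>

definition twice_beta_product_law :: "real \<Rightarrow> real \<Rightarrow> real measure" where
  "twice_beta_product_law a b =
     distr (beta_law a b \<Otimes>\<^sub>M beta_law a b) borel (\<lambda>(x, y). 2 * (x * y))"

text \<open>For \<open>\<alpha> < 2\<close> the integral of \<open>x\<close> against \<open>nu \<alpha> c\<close> is \<open>c\<^sup>2\<close>. For \<open>2 \<le> \<alpha> < 3\<close> it
  is infinite, while that of \<open>x\<^sup>2\<close> is finite: the points of a Poisson process with this
  intensity then have an infinite sum almost surely, and "sum minus \<open>c\<^sup>2\<close>" has a meaning only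
  as the compensated integral.\<close>

definition nu :: "real \<Rightarrow> real \<Rightarrow> real measure" where
  "nu \<alpha> c =
     restrict_space
       (if \<alpha> < 2
        then density (twice_beta_product_law (1 - \<alpha> / 2) (\<alpha> / 2))
               (\<lambda>x. ennreal (c\<^sup>2 / x))
        else density (twice_beta_product_law (2 - \<alpha> / 2) (\<alpha> / 2))
               (\<lambda>x. ennreal (2 * c\<^sup>2 * (c_coeff \<alpha> 2)\<^sup>2 / x\<^sup>2)))
       {0<..2}"

text \<open>The counting measure $\sum_i \delta_{x_i}$ on the measurable space \<open>S\<close>:
  the image of the counting measure on the index set, so multiplicities are counted.\<close>

definition dirac_sum :: "'a measure \<Rightarrow> (nat \<Rightarrow> 'a) \<Rightarrow> 'a measure" where
  "dirac_sum S x = distr (count_space UNIV) S x"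

text \<open>A set of infinite intensity has infinitely many points almost surely; a set of finite
  intensity \<open>r\<close> has a Poisson number of points with mean \<open>r\<close>, where \<open>r = 0\<close> is allowed
  (the library's \<^const>\<open>poisson_pmf\<close> needs a positive rate).\<close>

definition poisson_point_process ::
  "'w measure \<Rightarrow> 'a measure \<Rightarrow> ('w \<Rightarrow> 'a measure) \<Rightarrow> bool" where
  "poisson_point_process M \<nu> N \<longleftrightarrow>
     (\<forall>\<omega>\<in>space M. sets (N \<omega>) = sets \<nu>) \<and>
     (\<forall>A\<in>sets \<nu>. (\<lambda>\<omega>. emeasure (N \<omega>) A) \<in> borel_measurable M) \<and>
     (\<forall>A\<in>sets \<nu>. emeasure \<nu> A < \<infinity> \<longrightarrow>
        (\<forall>k::nat. measure M {\<omega> \<in> space M. emeasure (N \<omega>) A = of_nat k} =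
           measure \<nu> A ^ k / fact k * exp (- measure \<nu> A))) \<and>
     (\<forall>A\<in>sets \<nu>. emeasure \<nu> A = \<infinity> \<longrightarrow> (AE \<omega> in M. emeasure (N \<omega>) A = \<infinity>)) \<and>
     (\<forall>(n::nat) A. (\<forall>i<n. A i \<in> sets \<nu>) \<longrightarrow> disjoint_family_on A {..<n} \<longrightarrow>
        prob_space.indep_vars M (\<lambda>_. borel) (\<lambda>i \<omega>. emeasure (N \<omega>) (A i)) {..<n})"

text \<open>The integral of \<open>f\<close> over $(\varepsilon,\infty)$ against $N - \nu$.\<close>

definition truncated_compensated_integral ::
  "real measure \<Rightarrow> ('w \<Rightarrow> real measure) \<Rightarrow> (real \<Rightarrow> real) \<Rightarrow> real \<Rightarrow> 'w \<Rightarrow> real" where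
  "truncated_compensated_integral \<nu> N f \<epsilon> \<omega> =
     set_lebesgue_integral (N \<omega>) {\<epsilon><..} f - set_lebesgue_integral \<nu> {\<epsilon><..} f"

text \<open>\<open>X\<close> is (a version of) $\int f\,d(N-\nu)$, for a process of positive points that may accumulate
  only at \<open>0\<close>. Since \<open>N\<close> and \<open>\<nu>\<close> may both have infinite mass near \<open>0\<close>, their difference is not a
  signed measure, and, as is usual for compensated Poisson integrals, the integral is the
  limit in $L^2$ of the truncated integrals as the truncation level decreases to \<open>0\<close>.
  It is determined up to almost sure equality.\<close>

definition has_compensated_integral ::
  "'w measure \<Rightarrow> real measure \<Rightarrow> ('w \<Rightarrow> real measure) \<Rightarrow> (real \<Rightarrow> real) \<Rightarrow> ('w \<Rightarrow> real) \<Rightarrow> bool" where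
  "has_compensated_integral M \<nu> N f X \<longleftrightarrow>
     X \<in> borel_measurable M \<and>
     (\<forall>\<epsilon>>0. set_integrable \<nu> {\<epsilon><..} f \<and>
        (AE \<omega> in M. set_integrable (N \<omega>) {\<epsilon><..} f) \<and>
        truncated_compensated_integral \<nu> N f \<epsilon> \<in> borel_measurable M \<and>
        integrable M (\<lambda>\<omega>. (X \<omega> - truncated_compensated_integral \<nu> N f \<epsilon> \<omega>)\<^sup>2)) \<and>
     ((\<lambda>\<epsilon>. LINT \<omega>|M. (X \<omega> - truncated_compensated_integral \<nu> N f \<epsilon> \<omega>)\<^sup>2) \<longlongrightarrow> 0) (at_right 0)"

end

theory Submission
  imports Defs "HOL-Complex_Analysis.Laurent_Convergence"
begin

text \<open>
  The moments that define \<^const>\<open>eta\<close> are those of the law with cumulants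
  \<open>\<kappa> 1 = 0\<close> and \<open>\<kappa> m = c\<^sup>2 * 2 ^ (m - 1) * (c_coeff \<alpha> m)\<^sup>2\<close> for \<open>m \<ge> 2\<close>: the sum over tuples is what the
  power series \<open>exp (\<Sum>m\<ge>2. \<kappa> m * z ^ m / m!)\<close> gives when it is expanded (\<open>eta_moment_eq_fps\<close>). On
  the other hand \<open>c_coeff \<alpha> m\<close> is a moment of a Beta law, up to the factor \<open>c_coeff \<alpha> 2\<close> if
  \<open>\<alpha> \<ge> 2\<close>, and \<open>\<kappa> m\<close> is thus the \<open>m\<close>-th moment of the intensity \<open>nu \<alpha> c\<close> (\<open>nu_moment\<close>). By the
  exponential formula for Poisson processes, the cumulants of the compensated integral \<open>X\<close> of the
  identity are also \<open>0\<close> and then the moments of the intensity.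

  To make this precise, the exponential formula
  \<open>E exp (z * \<integral>\<^sub>B f dN) = exp (\<integral>\<^sub>B (exp (z * f) - 1) d\<nu>)\<close> is derived from the Poisson counts for
  complex \<open>z\<close> and sets \<open>B\<close> of finite intensity, by rounding \<open>f\<close> to step functions
  (\<open>laplace_functional\<close>). After compensation the exponent \<open>exp (z * x) - 1 - z * x\<close> is of
  order \<open>x\<^sup>2\<close>, which \<open>\<nu>\<close> integrates, and so the estimates are uniform in the truncation level. Real
  \<open>z\<close> yields a bound on the second moment of the difference of two truncated integrals, hence the
  existence of the limit \<open>X\<close> and its exponential moments; imaginary \<open>z\<close> yields the characteristic
  function of \<open>X\<close> (\<open>compensated_char\<close>).

  A law with exponential moments of all orders has an entire transform, so that the characteristic
  function determines the moments by comparison of Taylor coefficients; and the growth of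
  these moments makes them determine the law, by uniqueness of the characteristic function
  (\<open>moments_determine_law\<close>). This identifies the law of \<open>X\<close> with \<open>eta \<alpha> c\<close> (\<open>eta_unique\<close>).

  For \<open>\<alpha> < 2\<close> the intensity has the mean \<open>c\<^sup>2\<close>, by Campbell's formula the points are almost surely
  summable, and the truncated integrals converge pointwise to their sum minus \<open>c\<^sup>2\<close>
  (\<open>compensated_sum\<close>).
\<close>

section \<open>Poisson random variables\<close>

lemma poisson_weights_sums: "(\<lambda>k. (r::real) ^ k / fact k * exp (- r)) sums 1"
proof -
  have "(\<lambda>k. r ^ k / fact k * exp (- r)) sums (exp r * exp (- r))"
    using exp_converges[of r] by (intro sums_mult2) (simp add: divide_inverse mult.commute)
  then show ?thesis by (simp add: exp_minus)
qed

context prob_space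
begin

context
  fixes Y :: "'a \<Rightarrow> ennreal" and r :: real
  assumes Y [measurable]: "Y \<in> borel_measurable M" and r: "0 \<le> r"
    and Poisson: "\<And>k. prob {\<omega> \<in> space M. Y \<omega> = of_nat k} = r ^ k / fact k * exp (- r)"
begin

lemma poisson_AE_nat: "AE \<omega> in M. \<exists>k. Y \<omega> = of_nat k"
proof -
  let ?A = "\<lambda>k. {\<omega> \<in> space M. Y \<omega> = of_nat k}"
  have "(\<lambda>k. prob (?A k)) sums prob (\<Union>k. ?A k)"
    by (rule finite_measure_UNION) (auto simp: disjoint_family_on_def)
  then have "prob (\<Union>k. ?A k) = 1"
    using poisson_weights_sums[of r] by (simp add: Poisson sums_iff)
  from AE_prob_1[OF this] show ?thesis by eventually_elim auto
qed

text \<open>The count takes its values in \<^typ>\<open>ennreal\<close>. Off a null set it is a natural number, which the floor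
  recovers, and expectations of functions of the count become series over the Poisson weights. The
  weights are used in place of the Poisson \<open>pmf\<close> in order to include the rate \<open>0\<close>.\<close>

lemma poisson_distr:
  "distr M (count_space UNIV) (\<lambda>\<omega>. nat \<lfloor>enn2real (Y \<omega>)\<rfloor>) =
     density (count_space UNIV) (\<lambda>k. ennreal (r ^ k / fact k * exp (- r)))"
proof (rule measure_eqI_countable[where A=UNIV])
  fix k :: nat
  have "emeasure (distr M (count_space UNIV) (\<lambda>\<omega>. nat \<lfloor>enn2real (Y \<omega>)\<rfloor>)) {k}
      = emeasure M ((\<lambda>\<omega>. nat \<lfloor>enn2real (Y \<omega>)\<rfloor>) -` {k} \<inter> space M)"
    by (rule emeasure_distr) auto
  also have "\<dots> = emeasure M {\<omega> \<in> space M. Y \<omega> = of_nat k}"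
    by (rule emeasure_eq_AE) (use poisson_AE_nat in \<open>eventually_elim, auto\<close>)
  also have "\<dots> = ennreal (r ^ k / fact k * exp (- r))"
    by (simp add: emeasure_eq_measure Poisson)
  finally show "emeasure (distr M (count_space UNIV) (\<lambda>\<omega>. nat \<lfloor>enn2real (Y \<omega>)\<rfloor>)) {k}
      = emeasure (density (count_space UNIV) (\<lambda>k. ennreal (r ^ k / fact k * exp (- r)))) {k}"
    by (simp add: emeasure_density nn_integral_count_space_indicator[symmetric] nn_integral_count_space_finite one_ennreal_def[symmetric])
qed auto

lemma poisson_mean: "(\<integral>\<^sup>+\<omega>. Y \<omega> \<partial>M) = ennreal r"
proof -
  have "(\<integral>\<^sup>+\<omega>. Y \<omega> \<partial>M) = (\<integral>\<^sup>+\<omega>. of_nat (nat \<lfloor>enn2real (Y \<omega>)\<rfloor>) \<partial>M)"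
    by (rule nn_integral_cong_AE) (use poisson_AE_nat in \<open>eventually_elim, auto\<close>)
  also have "\<dots> = (\<integral>\<^sup>+k. of_nat k \<partial>distr M (count_space UNIV) (\<lambda>\<omega>. nat \<lfloor>enn2real (Y \<omega>)\<rfloor>))"
    by (subst nn_integral_distr) auto
  also have "\<dots> = (\<Sum>k. ennreal (r ^ k / fact k * exp (- r)) * of_nat k)"
    by (simp add: poisson_distr nn_integral_density nn_integral_count_space_nat)
  also have "\<dots> = (\<Sum>k. ennreal (r ^ k / fact k * exp (- r) * real k))"
    using r by (intro suminf_cong) (simp add: ennreal_of_nat_eq_real_of_nat flip: ennreal_mult)
  also have "\<dots> = ennreal r"
  proof (rule suminf_ennreal_eq)
    have "(\<lambda>k. r ^ Suc k / fact (Suc k) * exp (- r) * real (Suc k)) = (\<lambda>k. r * (r ^ k / fact k * exp (- r)))"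
      by (rule ext) (simp add: fact_Suc divide_simps del: of_nat_Suc)
    moreover have "(\<lambda>k. r * (r ^ k / fact k * exp (- r))) sums (r * 1)"
      by (intro sums_mult poisson_weights_sums)
    ultimately have "(\<lambda>k. r ^ Suc k / fact (Suc k) * exp (- r) * real (Suc k)) sums r"
      by simp
    then show "(\<lambda>k. r ^ k / fact k * exp (- r) * real k) sums r"
      by (subst (asm) sums_Suc_iff) simp
  qed (use r in auto)
  finally show ?thesis .
qed

lemma poisson_mgf:
  fixes z :: complex
  shows "integrable M (\<lambda>\<omega>. exp (z * of_real (enn2real (Y \<omega>))))"
    and "(\<integral>\<omega>. exp (z * of_real (enn2real (Y \<omega>))) \<partial>M) = exp (of_real r * (exp z - 1))"
proof -
  let ?K = "\<lambda>\<omega>. nat \<lfloor>enn2real (Y \<omega>)\<rfloor>"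
  let ?g = "\<lambda>k::nat. exp (z * of_nat k)"
  let ?t = "\<lambda>k::nat. (r ^ k / fact k * exp (- r)) *\<^sub>R ?g k"
  have t: "?t k = exp (- of_real r) * ((of_real r * exp z) ^ k /\<^sub>R fact k)" for k
  proof -
    have "exp (z * of_nat k) = exp z ^ k" by (metis exp_of_nat_mult mult.commute)
    then show ?thesis
      by (simp add: scaleR_conv_of_real power_mult_distrib divide_inverse flip: exp_of_real)
  qed
  have sums: "?t sums (exp (- of_real r) * exp (of_real r * exp z))"
    unfolding t by (intro sums_mult exp_converges)
  have summ: "summable (\<lambda>k. norm (?t k))"
    unfolding t norm_mult by (intro summable_mult summable_norm_exp)
  have int: "integrable (count_space UNIV) ?t"
    using summ by (simp add: integrable_count_space_nat_iff)
  have AE: "AE \<omega> in M. exp (z * of_real (enn2real (Y \<omega>))) = ?g (?K \<omega>)"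
    using poisson_AE_nat by eventually_elim auto
  have "integrable (distr M (count_space UNIV) ?K) ?g"
    unfolding poisson_distr using r int by (subst integrable_density) auto
  then have "integrable M (\<lambda>\<omega>. ?g (?K \<omega>))"
    by (subst (asm) integrable_distr_eq) auto
  then show "integrable M (\<lambda>\<omega>. exp (z * of_real (enn2real (Y \<omega>))))"
    by (subst integrable_cong_AE[OF _ _ AE]) auto
  have "(\<integral>\<omega>. exp (z * of_real (enn2real (Y \<omega>))) \<partial>M) = (\<integral>\<omega>. ?g (?K \<omega>) \<partial>M)"
    by (rule integral_cong_AE) (use AE in auto)
  also have "\<dots> = (\<integral>k. ?g k \<partial>distr M (count_space UNIV) ?K)"
    by (subst integral_distr) auto
  also have "\<dots> = (\<integral>k. ?t k \<partial>count_space UNIV)"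
    unfolding poisson_distr using r by (subst integral_density) auto
  also have "\<dots> = (\<Sum>k. ?t k)" by (rule integral_count_space_nat[OF int])
  also have "\<dots> = exp (- of_real r) * exp (of_real r * exp z)"
    using sums by (simp add: sums_iff)
  also have "\<dots> = exp (of_real r * (exp z - 1))"
    by (simp add: exp_add[symmetric] algebra_simps)
  finally show "(\<integral>\<omega>. exp (z * of_real (enn2real (Y \<omega>))) \<partial>M) = exp (of_real r * (exp z - 1))" .
qed

end

end

section \<open>The Laplace functional of a Poisson process\<close>

text \<open>The properties of a Poisson process used here concern only the kernel \<open>N\<close>, without an enumeration
  of its points.\<close>

locale poisson_process = prob_space M for M :: "'w measure" +
  fixes \<nu> :: "'a measure" and N :: "'w \<Rightarrow> 'a measure"
  assumes ppp: "poisson_point_process M \<nu> N"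
begin

lemma sets_N [measurable_cong]: "\<omega> \<in> space M \<Longrightarrow> sets (N \<omega>) = sets \<nu>"
  using ppp by (auto simp: poisson_point_process_def)

lemma space_N: "\<omega> \<in> space M \<Longrightarrow> space (N \<omega>) = space \<nu>"
  using sets_N by (rule sets_eq_imp_space_eq)

lemma measurable_N: "\<omega> \<in> space M \<Longrightarrow> f \<in> measurable \<nu> K \<Longrightarrow> f \<in> measurable (N \<omega>) K"
  using sets_N by (simp cong: measurable_cong_sets)

lemma emeasure_N_measurable [measurable]:
  "A \<in> sets \<nu> \<Longrightarrow> (\<lambda>\<omega>. emeasure (N \<omega>) A) \<in> borel_measurable M"
  using ppp by (auto simp: poisson_point_process_def)

lemma count_poisson:
  assumes "A \<in> sets \<nu>" "emeasure \<nu> A < \<infinity>"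
  shows "prob {\<omega> \<in> space M. emeasure (N \<omega>) A = of_nat k} =
           measure \<nu> A ^ k / fact k * exp (- measure \<nu> A)"
  using ppp assms by (auto simp: poisson_point_process_def)

lemma count_finite:
  assumes "A \<in> sets \<nu>" "emeasure \<nu> A < \<infinity>"
  shows "AE \<omega> in M. emeasure (N \<omega>) A < \<infinity>"
  using poisson_AE_nat[OF emeasure_N_measurable[OF assms(1)] measure_nonneg count_poisson[OF assms]]
  by eventually_elim (use assms in \<open>auto simp: of_nat_less_top\<close>)

lemma mean_count:
  assumes "A \<in> sets \<nu>"
  shows "(\<integral>\<^sup>+\<omega>. emeasure (N \<omega>) A \<partial>M) = emeasure \<nu> A"
proof (cases "emeasure \<nu> A = \<infinity>")
  case True
  then have "AE \<omega> in M. emeasure (N \<omega>) A = \<infinity>"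
    using ppp assms by (auto simp: poisson_point_process_def)
  then have "(\<integral>\<^sup>+\<omega>. emeasure (N \<omega>) A \<partial>M) = (\<integral>\<^sup>+\<omega>. \<infinity> \<partial>M)"
    by (rule nn_integral_cong_AE)
  then show ?thesis using True by (simp add: emeasure_space_1)
next
  case False
  then show ?thesis
    using poisson_mean[OF emeasure_N_measurable[OF assms] _ count_poisson[OF assms]]
    by (simp add: less_top emeasure_eq_ennreal_measure)
qed

text \<open>Campbell's formula and the measurability of \<open>\<omega> \<mapsto> \<integral> f dN \<omega>\<close> hold for indicators, and pass to all
  nonnegative functions by linearity and monotone convergence. Sets of infinite intensity are
  included, as almost surely they contain infinitely many points.\<close>

lemma campbell:
  assumes "f \<in> borel_measurable \<nu>"
  shows "(\<lambda>\<omega>. \<integral>\<^sup>+x. f x \<partial>N \<omega>) \<in> borel_measurable M"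
    and "(\<integral>\<^sup>+\<omega>. \<integral>\<^sup>+x. f x \<partial>N \<omega> \<partial>M) = (\<integral>\<^sup>+x. f x \<partial>\<nu>)"
proof -
  have "(\<lambda>\<omega>. \<integral>\<^sup>+x. f x \<partial>N \<omega>) \<in> borel_measurable M \<and>
    (\<integral>\<^sup>+\<omega>. \<integral>\<^sup>+x. f x \<partial>N \<omega> \<partial>M) = (\<integral>\<^sup>+x. f x \<partial>\<nu>)"
    using assms
  proof (induction rule: borel_measurable_induct)
    case (cong f g)
    have "(\<integral>\<^sup>+x. g x \<partial>N \<omega>) = (\<integral>\<^sup>+x. f x \<partial>N \<omega>)" if "\<omega> \<in> space M" for \<omega>
      using cong(3) space_N[OF that] by (intro nn_integral_cong) auto
    moreover have "(\<integral>\<^sup>+x. g x \<partial>\<nu>) = (\<integral>\<^sup>+x. f x \<partial>\<nu>)"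
      using cong(3) by (intro nn_integral_cong) auto
    ultimately show ?case using cong(4)
      by (simp cong: measurable_cong nn_integral_cong)
  next
    case (set A)
    have "(\<integral>\<^sup>+x. indicator A x \<partial>N \<omega>) = emeasure (N \<omega>) A" if "\<omega> \<in> space M" for \<omega>
      using set sets_N[OF that] by simp
    then show ?case using set
      by (simp add: mean_count cong: measurable_cong nn_integral_cong)
  next
    case (mult u c)
    have "(\<integral>\<^sup>+x. c * u x \<partial>N \<omega>) = c * (\<integral>\<^sup>+x. u x \<partial>N \<omega>)" if "\<omega> \<in> space M" for \<omega>
      using mult measurable_N[OF that] by (intro nn_integral_cmult) auto
    moreover have [measurable]: "(\<lambda>\<omega>. \<integral>\<^sup>+x. u x \<partial>N \<omega>) \<in> borel_measurable M"
      using mult by simp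
    have "(\<lambda>\<omega>. c * (\<integral>\<^sup>+x. u x \<partial>N \<omega>)) \<in> borel_measurable M" by measurable
    ultimately show ?case using mult
      by (simp add: nn_integral_cmult cong: measurable_cong nn_integral_cong)
  next
    case (add u v)
    have "(\<integral>\<^sup>+x. v x + u x \<partial>N \<omega>) = (\<integral>\<^sup>+x. v x \<partial>N \<omega>) + (\<integral>\<^sup>+x. u x \<partial>N \<omega>)" if "\<omega> \<in> space M" for \<omega>
      using add measurable_N[OF that] by (intro nn_integral_add) auto
    moreover have [measurable]: "(\<lambda>\<omega>. \<integral>\<^sup>+x. u x \<partial>N \<omega>) \<in> borel_measurable M"
        "(\<lambda>\<omega>. \<integral>\<^sup>+x. v x \<partial>N \<omega>) \<in> borel_measurable M"
      using add by simp_all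
    have "(\<lambda>\<omega>. (\<integral>\<^sup>+x. v x \<partial>N \<omega>) + (\<integral>\<^sup>+x. u x \<partial>N \<omega>)) \<in> borel_measurable M" by measurable
    ultimately show ?case using add
      by (simp add: nn_integral_add cong: measurable_cong nn_integral_cong)
  next
    case (seq U)
    have *: "(\<integral>\<^sup>+x. (SUP i. U i) x \<partial>N \<omega>) = (SUP i. \<integral>\<^sup>+x. U i x \<partial>N \<omega>)" if "\<omega> \<in> space M" for \<omega>
      unfolding SUP_apply
      using seq by (intro nn_integral_monotone_convergence_SUP measurable_N[OF that]) auto
    have "(\<integral>\<^sup>+\<omega>. (SUP i. \<integral>\<^sup>+x. U i x \<partial>N \<omega>) \<partial>M) = (SUP i. \<integral>\<^sup>+\<omega>. \<integral>\<^sup>+x. U i x \<partial>N \<omega> \<partial>M)"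
      using seq by (intro nn_integral_monotone_convergence_SUP)
        (auto simp: incseq_def le_fun_def intro!: nn_integral_mono)
    moreover have "(\<integral>\<^sup>+x. (SUP i. U i) x \<partial>\<nu>) = (SUP i. \<integral>\<^sup>+x. U i x \<partial>\<nu>)"
      unfolding SUP_apply using seq by (intro nn_integral_monotone_convergence_SUP) auto
    moreover have [measurable]: "\<And>i. (\<lambda>\<omega>. \<integral>\<^sup>+x. U i x \<partial>N \<omega>) \<in> borel_measurable M"
      using seq by simp
    have "(\<lambda>\<omega>. SUP i. \<integral>\<^sup>+x. U i x \<partial>N \<omega>) \<in> borel_measurable M" by measurable
    ultimately show ?case using seq *
      by (simp cong: measurable_cong nn_integral_cong)
  qed
  then show "(\<lambda>\<omega>. \<integral>\<^sup>+x. f x \<partial>N \<omega>) \<in> borel_measurable M"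
    and "(\<integral>\<^sup>+\<omega>. \<integral>\<^sup>+x. f x \<partial>N \<omega> \<partial>M) = (\<integral>\<^sup>+x. f x \<partial>\<nu>)" by auto
qed

lemma count_mgf:
  fixes z :: complex
  assumes "A \<in> sets \<nu>" "emeasure \<nu> A < \<infinity>"
  shows "integrable M (\<lambda>\<omega>. exp (z * of_real (measure (N \<omega>) A)))"
    and "(\<integral>\<omega>. exp (z * of_real (measure (N \<omega>) A)) \<partial>M) = exp (of_real (measure \<nu> A) * (exp z - 1))"
  using poisson_mgf[OF emeasure_N_measurable[OF assms(1)] _ count_poisson[OF assms]]
  by (simp_all add: measure_def)

lemma count_real_exp_integrable:
  assumes "A \<in> sets \<nu>" "emeasure \<nu> A < \<infinity>"
  shows "integrable M (\<lambda>\<omega>. exp (t * measure (N \<omega>) A))"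
  using integrable_norm[OF count_mgf(1)[OF assms, of "of_real t"]] by simp

lemma measure_N_measurable [measurable]:
  "A \<in> sets \<nu> \<Longrightarrow> (\<lambda>\<omega>. measure (N \<omega>) A) \<in> borel_measurable M"
  unfolding measure_def by measurable

text \<open>The exponential formula for step functions is the independence of the counts of disjoint sets.\<close>

lemma laplace_steps:
  fixes a :: "nat \<Rightarrow> complex"
  assumes A: "\<And>j. j < n \<Longrightarrow> A j \<in> sets \<nu>" "\<And>j. j < n \<Longrightarrow> emeasure \<nu> (A j) < \<infinity>"
    and disj: "disjoint_family_on A {..<n}"
  shows "(\<integral>\<omega>. exp (\<Sum>j<n. a j * of_real (measure (N \<omega>) (A j))) \<partial>M)
      = exp (\<Sum>j<n. of_real (measure \<nu> (A j)) * (exp (a j) - 1))"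
proof -
  have "indep_vars (\<lambda>_. borel) (\<lambda>i \<omega>. emeasure (N \<omega>) (A i)) {..<n}"
    using ppp A disj by (auto simp: poisson_point_process_def)
  then have ind: "indep_vars (\<lambda>_. borel) (\<lambda>i \<omega>. exp (a i * of_real (enn2real (emeasure (N \<omega>) (A i))))) {..<n}"
    by (rule indep_vars_compose2) auto
  note ind = ind[folded measure_def]
  have int: "integrable M (\<lambda>\<omega>. exp (a j * of_real (measure (N \<omega>) (A j))))" if "j \<in> {..<n}" for j
    using A that by (intro count_mgf(1)) auto
  have eq: "(\<integral>\<omega>. exp (a j * of_real (measure (N \<omega>) (A j))) \<partial>M)
      = exp (of_real (measure \<nu> (A j)) * (exp (a j) - 1))" if "j \<in> {..<n}" for j
    using A that by (intro count_mgf(2)) auto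
  have "(\<integral>\<omega>. (\<Prod>j<n. exp (a j * of_real (measure (N \<omega>) (A j)))) \<partial>M)
      = (\<Prod>j<n. \<integral>\<omega>. exp (a j * of_real (measure (N \<omega>) (A j))) \<partial>M)"
    by (rule indep_vars_lebesgue_integral[OF _ ind int]) auto
  also have "\<dots> = (\<Prod>j<n. exp (of_real (measure \<nu> (A j)) * (exp (a j) - 1)))"
    by (intro prod.cong refl eq)
  finally show "(\<integral>\<omega>. exp (\<Sum>j<n. a j * of_real (measure (N \<omega>) (A j))) \<partial>M)
      = exp (\<Sum>j<n. of_real (measure \<nu> (A j)) * (exp (a j) - 1))"
    unfolding exp_sum[OF finite_lessThan] .
qed

text \<open>For outcomes at which \<open>f\<close> is not integrable the Bochner integral and \<^const>\<open>enn2real\<close> of the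
  infinite nonnegative integral both are \<open>0\<close>, hence measurability holds without any restriction to
  a set of full measure.\<close>

lemma set_integral_N_measurable:
  fixes f :: "'a \<Rightarrow> real"
  assumes [measurable]: "f \<in> borel_measurable \<nu>" "B \<in> sets \<nu>" and nonneg: "\<And>x. x \<in> B \<Longrightarrow> 0 \<le> f x"
  shows "(\<lambda>\<omega>. set_lebesgue_integral (N \<omega>) B f) \<in> borel_measurable M"
proof -
  have 1: "set_lebesgue_integral (N \<omega>) B f = enn2real (\<integral>\<^sup>+x. ennreal (indicator B x * f x) \<partial>N \<omega>)"
    if "\<omega> \<in> space M" for \<omega>
    unfolding set_lebesgue_integral_def using nonneg
    by (simp, intro integral_eq_nn_integral measurable_N[OF that]) (auto simp: indicator_def)
  have 2: "(\<lambda>x. ennreal (indicator B x * f x)) \<in> borel_measurable \<nu>" by measurable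
  have [measurable]: "(\<lambda>\<omega>. \<integral>\<^sup>+x. ennreal (indicator B x * f x) \<partial>N \<omega>) \<in> borel_measurable M"
    using campbell(1)[OF 2] .
  have "(\<lambda>\<omega>. enn2real (\<integral>\<^sup>+x. ennreal (indicator B x * f x) \<partial>N \<omega>)) \<in> borel_measurable M"
    by measurable
  then show ?thesis by (simp add: 1 cong: measurable_cong)
qed

text \<open>The exponential formula for a function \<open>f\<close> with \<open>0 \<le> f < m\<close> on a set \<open>B\<close> of finite intensity.
  The function is rounded down to multiples of \<open>1 / (k + 1)\<close>; the rounded function is constant on
  finitely many level sets, which are disjoint.\<close>

context
  fixes f :: "'a \<Rightarrow> real" and B :: "'a set" and m :: nat
  assumes f [measurable]: "f \<in> borel_measurable \<nu>"
    and B [measurable]: "B \<in> sets \<nu>" and finB: "emeasure \<nu> B < \<infinity>"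
    and f_range: "\<And>x. x \<in> B \<Longrightarrow> 0 \<le> f x" "\<And>x. x \<in> B \<Longrightarrow> f x < m"
begin

private definition "rounded k x = real (nat \<lfloor>real (Suc k) * f x\<rfloor>) / real (Suc k)"
private definition "level k j = {x \<in> space \<nu>. x \<in> B \<and> nat \<lfloor>real (Suc k) * f x\<rfloor> = j}"

private lemma rounded_measurable [measurable]: "rounded k \<in> borel_measurable \<nu>"
  unfolding rounded_def by measurable

private lemma level_sets [measurable]: "level k j \<in> sets \<nu>"
  unfolding level_def by measurable

private lemma level_sub: "level k j \<subseteq> B"
  by (auto simp: level_def)

private lemma level_fin: "emeasure \<nu> (level k j) < \<infinity>"
  using emeasure_mono[OF level_sub B] finB by (rule le_less_trans)

private lemma B_space: "x \<in> B \<Longrightarrow> x \<in> space \<nu>"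
  using sets.sets_into_space[OF B] by auto

private lemma rounded_bounds:
  assumes "x \<in> B" shows "0 \<le> rounded k x" "rounded k x \<le> f x" "f x - rounded k x \<le> 1 / real (Suc k)"
    "nat \<lfloor>real (Suc k) * f x\<rfloor> < m * Suc k"
proof -
  have 0: "0 \<le> real (Suc k) * f x" using f_range(1)[OF assms] by simp
  have 1: "real (nat \<lfloor>real (Suc k) * f x\<rfloor>) \<le> real (Suc k) * f x"
    using 0 by linarith
  have 2: "real (Suc k) * f x \<le> real (nat \<lfloor>real (Suc k) * f x\<rfloor>) + 1"
    using 0 by linarith
  show "0 \<le> rounded k x" by (simp add: rounded_def)
  show "rounded k x \<le> f x" using 1 unfolding rounded_def by (simp add: pos_divide_le_eq mult.commute)
  have "f x \<le> (real (nat \<lfloor>real (Suc k) * f x\<rfloor>) + 1) / real (Suc k)"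
    using 2 by (simp add: pos_le_divide_eq mult.commute)
  then show "f x - rounded k x \<le> 1 / real (Suc k)"
    unfolding rounded_def by (simp add: add_divide_distrib)
  have "real (Suc k) * f x < real (Suc k) * m" using f_range(2)[OF assms] by (intro mult_strict_left_mono) auto
  with 1 have "real (nat \<lfloor>real (Suc k) * f x\<rfloor>) < real (Suc k) * real m"
    by (rule le_less_trans)
  also have "\<dots> = real (m * Suc k)" by (simp only: of_nat_mult mult.commute)
  finally have "real (nat \<lfloor>real (Suc k) * f x\<rfloor>) < real (m * Suc k)" .
  then show "nat \<lfloor>real (Suc k) * f x\<rfloor> < m * Suc k" by (simp only: of_nat_less_iff)
qed

private lemma rounded_lim: "x \<in> B \<Longrightarrow> (\<lambda>k. rounded k x) \<longlonglongrightarrow> f x"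
proof (rule tendsto_sandwich[of "\<lambda>k. f x - 1 / real (Suc k)" _ _ "\<lambda>_. f x"])
  assume x: "x \<in> B"
  show "\<forall>\<^sub>F k in sequentially. f x - 1 / real (Suc k) \<le> rounded k x"
    using rounded_bounds(3)[OF x] by (simp add: algebra_simps)
  show "\<forall>\<^sub>F k in sequentially. rounded k x \<le> f x" using rounded_bounds(2)[OF x] by simp
  show "(\<lambda>k. f x - 1 / real (Suc k)) \<longlonglongrightarrow> f x"
    using tendsto_diff[OF tendsto_const LIMSEQ_inverse_real_of_nat, of "f x"] by (simp add: divide_inverse)
qed simp

text \<open>Stated for an arbitrary measure \<open>Q\<close>, since it is applied both to the intensity \<open>\<nu>\<close> and to the
  realisations \<open>N \<omega>\<close>.\<close>

private lemma integral_steps: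
  fixes h :: "real \<Rightarrow> 'c :: {banach, second_countable_topology}"
  assumes Q: "sets Q = sets \<nu>" "emeasure Q B < \<infinity>"
  shows "set_lebesgue_integral Q B (\<lambda>x. h (rounded k x)) =
    (\<Sum>j<m * Suc k. measure Q (level k j) *\<^sub>R h (real j / real (Suc k)))"
proof -
  have sp: "space Q = space \<nu>" using Q(1) by (rule sets_eq_imp_space_eq)
  have level: "level k j \<in> sets Q" for j using Q by simp
  have fin: "emeasure Q (level k j) < \<infinity>" for j
    using emeasure_mono[of "level k j" B Q] level_sub Q by (metis B le_less_trans)
  have "indicat_real B x *\<^sub>R h (rounded k x) =
    (\<Sum>j<m * Suc k. indicat_real (level k j) x *\<^sub>R h (real j / real (Suc k)))" for x
  proof (cases "x \<in> B")
    case True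
    have "(\<Sum>j<m * Suc k. indicat_real (level k j) x *\<^sub>R h (real j / real (Suc k)))
        = (\<Sum>j<m * Suc k. if j = nat \<lfloor>real (Suc k) * f x\<rfloor> then h (real j / real (Suc k)) else 0)"
      using True B_space[OF True] by (intro sum.cong) (auto simp: level_def)
    also have "\<dots> = h (rounded k x)" using rounded_bounds(4)[OF True] by (simp add: rounded_def)
    finally show ?thesis using True by simp
  next
    case False
    then have "x \<notin> level k j" for j using level_sub by auto
    with False show ?thesis by simp
  qed
  then have "set_lebesgue_integral Q B (\<lambda>x. h (rounded k x)) =
     (\<integral>x. (\<Sum>j<m * Suc k. indicat_real (level k j) x *\<^sub>R h (real j / real (Suc k))) \<partial>Q)"
    unfolding set_lebesgue_integral_def by presburger
  also have "\<dots> = (\<Sum>j<m * Suc k. \<integral>x. indicat_real (level k j) x *\<^sub>R h (real j / real (Suc k)) \<partial>Q)"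
    using level fin by (intro Bochner_Integration.integral_sum integrable_scaleR_left) auto
  also have "\<dots> = (\<Sum>j<m * Suc k. measure Q (level k j) *\<^sub>R h (real j / real (Suc k)))"
    using level fin sp by (intro sum.cong refl) (auto simp: level_def Int_absorb2 dest: sets.sets_into_space)
  finally show ?thesis .
qed

private lemma integral_steps_lim:
  fixes h :: "real \<Rightarrow> 'c :: {banach, second_countable_topology}"
  assumes Q: "sets Q = sets \<nu>" "emeasure Q B < \<infinity>"
    and h: "continuous_on UNIV h"
  shows "(\<lambda>k. set_lebesgue_integral Q B (\<lambda>x. h (rounded k x))) \<longlonglongrightarrow> set_lebesgue_integral Q B (\<lambda>x. h (f x))"
proof -
  have [measurable]: "h \<in> borel_measurable borel" by (rule borel_measurable_continuous_onI[OF h])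
  have [measurable_cong]: "sets Q = sets \<nu>" by fact
  have "bounded (h ` {0..real m})"
    by (intro compact_imp_bounded compact_continuous_image continuous_on_subset[OF h]) auto
  then obtain C where C: "\<And>y. 0 \<le> y \<Longrightarrow> y \<le> real m \<Longrightarrow> norm (h y) \<le> C"
    by (force simp: bounded_iff)
  show ?thesis unfolding set_lebesgue_integral_def
  proof (rule integral_dominated_convergence[where w="\<lambda>x. C * indicator B x"])
    show "integrable Q (\<lambda>x. C * indicator B x)" using Q by simp
    show "AE x in Q. (\<lambda>k. indicat_real B x *\<^sub>R h (rounded k x)) \<longlonglongrightarrow> indicat_real B x *\<^sub>R h (f x)"
      using rounded_lim h by (intro AE_I2) (auto simp: indicator_def continuous_on_eq_continuous_at intro!: isCont_tendsto_compose[where g=h])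
    show "AE x in Q. norm (indicat_real B x *\<^sub>R h (rounded k x)) \<le> C * indicator B x" for k
    proof (rule AE_I2)
      fix x show "norm (indicat_real B x *\<^sub>R h (rounded k x)) \<le> C * indicator B x"
        using C[of "rounded k x"] rounded_bounds[of x k] f_range(2)[of x] by (auto simp: indicator_def)
    qed
  qed measurable
qed

text \<open>The step functions satisfy the formula, and both sides converge: the right-hand side by dominated
  convergence under \<open>\<nu>\<close>, the left-hand side because the integrals of the rounded functions
  converge for almost every realisation and are at most \<open>m\<close> times the number of points in \<open>B\<close>,
  which has exponential moments.\<close>

lemma laplace_functional:
  fixes z :: complex
  shows "integrable M (\<lambda>\<omega>. exp (z * of_real (set_lebesgue_integral (N \<omega>) B f)))"
    and "(\<integral>\<omega>. exp (z * of_real (set_lebesgue_integral (N \<omega>) B f)) \<partial>M)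
      = exp (set_lebesgue_integral \<nu> B (\<lambda>x. exp (z * of_real (f x)) - 1))"
proof -
  define L where "L k \<omega> = (\<Sum>j<m * Suc k. measure (N \<omega>) (level k j) *\<^sub>R complex_of_real (real j / real (Suc k)))" for k \<omega>
  note fin = count_finite[OF B finB]
  have L_meas [measurable]: "L k \<in> borel_measurable M" for k
    unfolding L_def by measurable
  have L_eq: "z * L k \<omega> = (\<Sum>j<m * Suc k. (z * of_real (real j / real (Suc k))) * of_real (measure (N \<omega>) (level k j)))" for k \<omega>
    by (simp add: L_def sum_distrib_left scaleR_conv_of_real mult_ac)
  have disj: "disjoint_family_on (level k) J" for k J by (auto simp: disjoint_family_on_def level_def)
  have E: "(\<integral>\<omega>. exp (z * L k \<omega>) \<partial>M) = exp (set_lebesgue_integral \<nu> B (\<lambda>x. exp (z * of_real (rounded k x)) - 1))" for k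
    unfolding L_eq
    by (subst laplace_steps[OF level_sets level_fin disj],
        subst integral_steps[OF refl finB, of "\<lambda>y. exp (z * of_real y) - 1"])
       (simp add: scaleR_conv_of_real)
  have NL: "L k \<omega> = set_lebesgue_integral (N \<omega>) B (\<lambda>x. complex_of_real (rounded k x))"
    if "\<omega> \<in> space M" "emeasure (N \<omega>) B < \<infinity>" for k \<omega>
    using that by (subst integral_steps[OF sets_N, of _ "of_real"]) (auto simp: L_def)
  have lim: "AE \<omega> in M. (\<lambda>k. L k \<omega>) \<longlonglongrightarrow> of_real (set_lebesgue_integral (N \<omega>) B f)"
    using fin AE_space
  proof eventually_elim
    case (elim \<omega>)
    have "(\<lambda>k. set_lebesgue_integral (N \<omega>) B (\<lambda>x. complex_of_real (rounded k x))) \<longlonglongrightarrow>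
      set_lebesgue_integral (N \<omega>) B (\<lambda>x. complex_of_real (f x))"
      by (rule integral_steps_lim) (use elim sets_N in \<open>auto intro!: continuous_intros\<close>)
    then show ?case using NL[OF elim(2,1)]
      by (simp add: set_lebesgue_integral_def scaleR_conv_of_real flip: of_real_mult)
  qed
  have [measurable]: "(\<lambda>\<omega>. set_lebesgue_integral (N \<omega>) B f) \<in> borel_measurable M"
    using set_integral_N_measurable[OF f B f_range(1)] .
  have L_bd: "norm (L k \<omega>) \<le> m * measure (N \<omega>) B" if "\<omega> \<in> space M" "emeasure (N \<omega>) B < \<infinity>" for k \<omega>
  proof -
    have [measurable_cong]: "sets (N \<omega>) = sets \<nu>" using sets_N[OF that(1)] .
    have i: "integrable (N \<omega>) (\<lambda>x. real m * indicator B x)" using that by simp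
    have bd: "norm (indicat_real B x *\<^sub>R complex_of_real (rounded k x)) \<le> real m * indicator B x" for x
      using rounded_bounds[of x k] f_range(2)[of x] by (auto simp: indicator_def)
    have i': "integrable (N \<omega>) (\<lambda>x. indicat_real B x *\<^sub>R complex_of_real (rounded k x))"
      by (rule Bochner_Integration.integrable_bound[OF i]) (use bd in \<open>auto simp: abs_mult\<close>)
    have "norm (L k \<omega>) \<le> (\<integral>x. real m * indicator B x \<partial>N \<omega>)"
      unfolding NL[OF that] set_lebesgue_integral_def
      by (rule order_trans[OF integral_norm_bound integral_mono[OF integrable_norm[OF i'] i bd]])
    also have "\<dots> = m * measure (N \<omega>) B"
      using that B_space by (auto simp: space_N Int_absorb2 subset_iff)
    finally show ?thesis .
  qed
  let ?w = "\<lambda>\<omega>. exp (norm z * m * measure (N \<omega>) B)"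
  have w: "integrable M ?w"
    using count_real_exp_integrable[OF B finB, of "norm z * m"] by simp
  have bd: "AE \<omega> in M. norm (exp (z * L k \<omega>)) \<le> ?w \<omega>" for k
    using fin AE_space
  proof eventually_elim
    case (elim \<omega>)
    have "Re (z * L k \<omega>) \<le> norm z * norm (L k \<omega>)" by (metis complex_Re_le_cmod norm_mult)
    also have "\<dots> \<le> norm z * (m * measure (N \<omega>) B)" by (intro mult_left_mono L_bd elim) auto
    finally show ?case by (simp add: mult.assoc)
  qed
  have lim': "AE \<omega> in M. (\<lambda>k. exp (z * L k \<omega>)) \<longlonglongrightarrow> exp (z * of_real (set_lebesgue_integral (N \<omega>) B f))"
    using lim by eventually_elim (intro tendsto_intros)
  show "integrable M (\<lambda>\<omega>. exp (z * of_real (set_lebesgue_integral (N \<omega>) B f)))"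
    by (rule integrable_dominated_convergence[OF _ _ w lim' bd]) measurable
  have "(\<lambda>k. \<integral>\<omega>. exp (z * L k \<omega>) \<partial>M) \<longlonglongrightarrow> (\<integral>\<omega>. exp (z * of_real (set_lebesgue_integral (N \<omega>) B f)) \<partial>M)"
    by (rule integral_dominated_convergence[OF _ _ w lim' bd]) measurable
  moreover have "(\<lambda>k. \<integral>\<omega>. exp (z * L k \<omega>) \<partial>M) \<longlonglongrightarrow>
      exp (set_lebesgue_integral \<nu> B (\<lambda>x. exp (z * of_real (f x)) - 1))"
    unfolding E by (intro tendsto_exp integral_steps_lim[OF refl finB]) (auto intro!: continuous_intros)
  ultimately show "(\<integral>\<omega>. exp (z * of_real (set_lebesgue_integral (N \<omega>) B f)) \<partial>M)
      = exp (set_lebesgue_integral \<nu> B (\<lambda>x. exp (z * of_real (f x)) - 1))"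
    by (rule LIMSEQ_unique)
qed

end

end

section \<open>The compensated integral\<close>

lemma norm_exp_minus_1_minus_le:
  fixes w :: complex
  shows "norm (exp w - 1 - w) \<le> norm w ^ 2 * exp (norm w)"
proof -
  have "norm (exp w - 1 - w) \<le> exp \<bar>Re w\<bar> * norm w ^ 2"
    using Taylor_exp[of w 1] by (simp add: algebra_simps power2_eq_square)
  also have "\<dots> \<le> norm w ^ 2 * exp (norm w)"
    using abs_Re_le_cmod[of w] by (simp add: mult.commute mult_right_mono)
  finally show ?thesis .
qed

lemma square_le_exp:
  fixes y :: real
  shows "y\<^sup>2 \<le> 2 * (exp y + exp (- y) - 2)"
proof -
  have *: "y\<^sup>2 \<le> 2 * (exp y + exp (- y) - 2)" if "0 \<le> y" for y :: real
    using exp_lower_Taylor_quadratic[OF that] exp_ge_add_one_self[of "- y"] by simp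
  show ?thesis using *[of y] *[of "- y"] by (cases "0 \<le> y") (auto simp: algebra_simps)
qed

text \<open>An intensity on \<open>(0, 2]\<close> that may have infinite mass, and even an infinite mean, near \<open>0\<close>, but a
  finite second moment, which is what compensation requires.\<close>

locale compensated_jumps = poisson_process M \<nu> N
  for M :: "'w measure" and \<nu> :: "real measure" and N :: "'w \<Rightarrow> real measure" +
  assumes sets_nu: "sets \<nu> = sets (restrict_space borel {0<..2})"
    and square_integrable: "integrable \<nu> (\<lambda>x. x\<^sup>2)"
begin

lemma space_nu: "space \<nu> = {0<..2}"
  using sets_eq_imp_space_eq[OF sets_nu] by (simp add: space_restrict_space)

lemma measurable_nu [measurable (raw)]: "f \<in> borel_measurable borel \<Longrightarrow> f \<in> borel_measurable \<nu>"
  by (simp add: measurable_cong_sets[OF sets_nu refl] measurable_restrict_space1)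

definition band :: "real \<Rightarrow> real \<Rightarrow> real set" where
  "band a b = {a<..b} \<inter> {0<..2}"

lemma band_sets [measurable]: "band a b \<in> sets \<nu>"
  unfolding sets_nu band_def by (auto simp: sets_restrict_space)

lemma band_bounds: "x \<in> band a b \<Longrightarrow> 0 < x \<and> x \<le> 2 \<and> a < x \<and> x \<le> b"
  by (simp add: band_def)

definition energy :: "real set \<Rightarrow> real" where
  "energy B = set_lebesgue_integral \<nu> B (\<lambda>x. x\<^sup>2)"

lemma set_square_integrable: "B \<in> sets \<nu> \<Longrightarrow> set_integrable \<nu> B (\<lambda>x. x\<^sup>2)"
  unfolding set_integrable_def using integrable_mult_indicator[OF _ square_integrable] by simp

lemma energy_mono:
  assumes "A \<in> sets \<nu>" "B \<in> sets \<nu>" "A \<subseteq> B" shows "energy A \<le> energy B"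
  unfolding energy_def set_lebesgue_integral_def
  by (intro integral_mono set_square_integrable[unfolded set_integrable_def] assms)
     (use assms in \<open>auto simp: indicator_def\<close>)

lemma energy_nonneg: "0 \<le> energy B"
  unfolding energy_def set_lebesgue_integral_def by (intro integral_nonneg_AE) auto

lemma band_finite:
  assumes "0 < a" shows "emeasure \<nu> (band a b) < \<infinity>"
proof -
  have "emeasure \<nu> (band a b) = (\<integral>\<^sup>+x. indicator (band a b) x \<partial>\<nu>)" by simp
  also have "\<dots> \<le> (\<integral>\<^sup>+x. ennreal (x\<^sup>2 / a\<^sup>2) \<partial>\<nu>)"
  proof (rule nn_integral_mono)
    fix x
    show "indicator (band a b) x \<le> ennreal (x\<^sup>2 / a\<^sup>2)"
    proof (cases "x \<in> band a b")
      case True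
      then have "a\<^sup>2 \<le> x\<^sup>2" using assms by (intro power_mono) (auto simp: band_def)
      then have "1 \<le> x\<^sup>2 / a\<^sup>2" using assms by (simp add: pos_le_divide_eq)
      then show ?thesis using True by simp
    qed simp
  qed
  also have "\<dots> < \<infinity>"
    using integrable_divide_zero[of "a\<^sup>2", OF square_integrable]
    by (simp add: integrable_iff_bounded)
  finally show ?thesis .
qed

lemma set_integrable_finite:
  fixes f :: "real \<Rightarrow> 'c :: {banach, second_countable_topology}"
  assumes Q: "sets Q = sets \<nu>" "emeasure Q B < \<infinity>" "B \<in> sets \<nu>" and f: "f \<in> borel_measurable \<nu>"
    and C: "\<And>x. x \<in> B \<Longrightarrow> norm (f x) \<le> C"
  shows "set_integrable Q B f"
  unfolding set_integrable_def
proof (rule Bochner_Integration.integrable_bound)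
  have [measurable_cong]: "sets Q = sets \<nu>" by fact
  note f [measurable] Q(3) [measurable]
  show "integrable Q (\<lambda>x. C * indicator B x)" using Q by simp
  show "(\<lambda>x. indicat_real B x *\<^sub>R f x) \<in> borel_measurable Q" by measurable
  show "AE x in Q. norm (indicat_real B x *\<^sub>R f x) \<le> norm (C * indicator B x)"
    using C by (intro AE_I2) (force simp: indicator_def)
qed

lemma set_integrable_band:
  fixes f :: "real \<Rightarrow> 'c :: {banach, second_countable_topology}"
  assumes "0 < a" "continuous_on UNIV f"
  shows "set_integrable \<nu> (band a b) f"
proof -
  have "bounded (f ` {0..2})"
    by (intro compact_imp_bounded compact_continuous_image continuous_on_subset[OF assms(2)]) auto
  then obtain C where "\<And>x. 0 \<le> x \<Longrightarrow> x \<le> 2 \<Longrightarrow> norm (f x) \<le> C" by (force simp: bounded_iff)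
  then show ?thesis
    using assms(1) by (intro set_integrable_finite[where C=C] band_finite)
      (auto dest!: band_bounds intro!: measurable_nu borel_measurable_continuous_onI[OF assms(2)])
qed

text \<open>The estimate behind everything that is uniform in the truncation: compensation leaves an exponent
  that is quadratic at \<open>0\<close>, and it is bounded by the second moment of \<open>\<nu>\<close> on \<open>B\<close>.\<close>

lemma cumulant_integrable:
  fixes z :: complex
  assumes B: "B \<in> sets \<nu>"
  shows "set_integrable \<nu> B (\<lambda>x. exp (z * of_real x) - 1 - z * of_real x)"
    and "norm (set_lebesgue_integral \<nu> B (\<lambda>x. exp (z * of_real x) - 1 - z * of_real x))
      \<le> norm z ^ 2 * exp (2 * norm z) * energy B"
proof -
  let ?f = "\<lambda>x. indicat_real B x *\<^sub>R (exp (z * of_real x) - 1 - z * of_real x)"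
  let ?w = "\<lambda>x. norm z ^ 2 * exp (2 * norm z) * (indicat_real B x *\<^sub>R x\<^sup>2)"
  have w: "integrable \<nu> ?w"
    using set_square_integrable[OF B] by (intro integrable_mult_right) (simp add: set_integrable_def)
  have bd: "norm (?f x) \<le> ?w x" if "x \<in> space \<nu>" for x
  proof (cases "x \<in> B")
    case True
    have x: "0 < x" "x \<le> 2" using that by (auto simp: space_nu)
    have "norm (exp (z * of_real x) - 1 - z * of_real x) \<le> (norm z * x) ^ 2 * exp (norm z * x)"
      using norm_exp_minus_1_minus_le[of "z * of_real x"] x by (simp add: norm_mult)
    also have "\<dots> \<le> (norm z * x) ^ 2 * exp (2 * norm z)"
    proof (intro mult_left_mono)
      have "norm z * x \<le> norm z * 2" using x by (intro mult_left_mono) auto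
      then show "exp (norm z * x) \<le> exp (2 * norm z)" by simp
    qed auto
    finally show ?thesis using True by (simp add: power_mult_distrib mult_ac)
  qed simp
  note B [measurable]
  have meas: "?f \<in> borel_measurable \<nu>" by measurable
  show i: "set_integrable \<nu> B (\<lambda>x. exp (z * of_real x) - 1 - z * of_real x)"
    unfolding set_integrable_def
    by (rule Bochner_Integration.integrable_bound[OF w meas], rule AE_I2, rule order_trans[OF bd]) auto
  have "norm (integral\<^sup>L \<nu> ?f) \<le> (\<integral>x. ?w x \<partial>\<nu>)"
    using i unfolding set_integrable_def
    by (intro order_trans[OF integral_norm_bound integral_mono[OF integrable_norm w bd]])
  then show "norm (set_lebesgue_integral \<nu> B (\<lambda>x. exp (z * of_real x) - 1 - z * of_real x))
      \<le> norm z ^ 2 * exp (2 * norm z) * energy B"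
    by (simp add: set_lebesgue_integral_def energy_def)
qed

definition compensated_band :: "real \<Rightarrow> real \<Rightarrow> 'w \<Rightarrow> real" where
  "compensated_band a b \<omega> = set_lebesgue_integral (N \<omega>) (band a b) (\<lambda>x. x) - set_lebesgue_integral \<nu> (band a b) (\<lambda>x. x)"

lemma compensated_band_measurable [measurable]: "compensated_band a b \<in> borel_measurable M"
proof -
  have [measurable]: "(\<lambda>\<omega>. set_lebesgue_integral (N \<omega>) (band a b) (\<lambda>x. x)) \<in> borel_measurable M"
    by (rule set_integral_N_measurable) (auto dest: band_bounds)
  show ?thesis unfolding compensated_band_def by measurable
qed

lemma compensated_band_mgf:
  fixes z :: complex
  assumes a: "0 < a"
  shows "integrable M (\<lambda>\<omega>. exp (z * of_real (compensated_band a b \<omega>)))"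
    and "(\<integral>\<omega>. exp (z * of_real (compensated_band a b \<omega>)) \<partial>M)
      = exp (set_lebesgue_integral \<nu> (band a b) (\<lambda>x. exp (z * of_real x) - 1 - z * of_real x))"
proof -
  let ?I = "\<lambda>\<omega>. set_lebesgue_integral (N \<omega>) (band a b) (\<lambda>x. x)"
  let ?c = "z * of_real (set_lebesgue_integral \<nu> (band a b) (\<lambda>x. x))"
  have eq: "exp (z * of_real (compensated_band a b \<omega>)) = exp (- ?c) * exp (z * of_real (?I \<omega>))" for \<omega>
    by (simp add: compensated_band_def exp_add[symmetric] algebra_simps)
  note lap = laplace_functional[where f="\<lambda>x. x" and m=3, OF _ band_sets band_finite[OF a]]
  have 1: "integrable M (\<lambda>\<omega>. exp (z * of_real (?I \<omega>)))"
    by (rule lap) (auto simp: band_def)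
  have 2: "(\<integral>\<omega>. exp (z * of_real (?I \<omega>)) \<partial>M) = exp (set_lebesgue_integral \<nu> (band a b) (\<lambda>x. exp (z * of_real x) - 1))"
    by (rule lap) (auto simp: band_def)
  show "integrable M (\<lambda>\<omega>. exp (z * of_real (compensated_band a b \<omega>)))"
    unfolding eq by (intro integrable_mult_right 1)
  have "?c = set_lebesgue_integral \<nu> (band a b) (\<lambda>x. z * of_real x)"
    by (simp add: set_integral_complex_of_real)
  then have "- ?c + set_lebesgue_integral \<nu> (band a b) (\<lambda>x. exp (z * of_real x) - 1)
    = set_lebesgue_integral \<nu> (band a b) (\<lambda>x. exp (z * of_real x) - 1 - z * of_real x)"
    using a by (subst set_integral_diff(2)) (auto intro!: set_integrable_band continuous_intros)
  moreover have "(\<integral>\<omega>. exp (z * of_real (compensated_band a b \<omega>)) \<partial>M)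
    = exp (- ?c + set_lebesgue_integral \<nu> (band a b) (\<lambda>x. exp (z * of_real x) - 1))"
    unfolding eq integral_mult_right_zero 2 exp_add by (rule refl)
  ultimately show "(\<integral>\<omega>. exp (z * of_real (compensated_band a b \<omega>)) \<partial>M)
      = exp (set_lebesgue_integral \<nu> (band a b) (\<lambda>x. exp (z * of_real x) - 1 - z * of_real x))"
    by (simp only:)
qed

lemma compensated_band_exp_bound:
  assumes a: "0 < a"
  shows "integrable M (\<lambda>\<omega>. exp (t * compensated_band a b \<omega>))"
    and "(\<integral>\<omega>. exp (t * compensated_band a b \<omega>) \<partial>M) \<le> exp (t\<^sup>2 * exp (2 * \<bar>t\<bar>) * energy (band a b))"
proof -
  have "integrable M (\<lambda>\<omega>. norm (exp (complex_of_real t * of_real (compensated_band a b \<omega>))))"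
    using compensated_band_mgf(1)[OF a] by (rule integrable_norm)
  then show "integrable M (\<lambda>\<omega>. exp (t * compensated_band a b \<omega>))" by simp
  let ?C = "set_lebesgue_integral \<nu> (band a b) (\<lambda>x. exp (complex_of_real t * of_real x) - 1 - complex_of_real t * of_real x)"
  have "complex_of_real (\<integral>\<omega>. exp (t * compensated_band a b \<omega>) \<partial>M) = exp ?C"
  proof -
    have "exp (complex_of_real t * of_real (compensated_band a b \<omega>)) = complex_of_real (exp (t * compensated_band a b \<omega>))" for \<omega>
      by (metis exp_of_real of_real_mult)
    then show ?thesis unfolding compensated_band_mgf(2)[OF a, symmetric] by simp
  qed
  then have "norm (complex_of_real (\<integral>\<omega>. exp (t * compensated_band a b \<omega>) \<partial>M)) = norm (exp ?C)"
    by (rule arg_cong)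
  then have "\<bar>\<integral>\<omega>. exp (t * compensated_band a b \<omega>) \<partial>M\<bar> = exp (Re ?C)"
    by (simp only: norm_of_real norm_exp_eq_Re)
  then have "(\<integral>\<omega>. exp (t * compensated_band a b \<omega>) \<partial>M) \<le> exp (Re ?C)" by linarith
  also have "Re ?C \<le> norm ?C" by (rule complex_Re_le_cmod)
  also have "norm ?C \<le> t\<^sup>2 * exp (2 * \<bar>t\<bar>) * energy (band a b)"
    using cumulant_integrable(2)[OF band_sets, of a b "complex_of_real t"]
    by (simp only: norm_of_real power2_abs)
  finally show "(\<integral>\<omega>. exp (t * compensated_band a b \<omega>) \<partial>M) \<le> exp (t\<^sup>2 * exp (2 * \<bar>t\<bar>) * energy (band a b))"
    by simp
qed

text \<open>A bound for the second moment of a compensated integral over a set of energy \<open>v\<close>.\<close>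

definition modulus :: "real \<Rightarrow> real" where
  "modulus v = 4 * (exp (exp 2 * v) - 1)"

lemma modulus_mono: "v \<le> w \<Longrightarrow> modulus v \<le> modulus w"
  by (simp add: modulus_def)

text \<open>By \<open>y\<^sup>2 \<le> 2 * (exp y + exp (- y) - 2)\<close>, the exponential formula at \<open>1\<close> and \<open>- 1\<close> bounds the second
  moment by a quantity that vanishes with the energy of the band. This takes the place of the
  variance identity for compensated integrals.\<close>

lemma compensated_band_second_moment:
  assumes a: "0 < a"
  shows "(\<integral>\<^sup>+\<omega>. ennreal ((compensated_band a b \<omega>)\<^sup>2) \<partial>M) \<le> ennreal (modulus (energy (band a b)))"
proof -
  note i = compensated_band_exp_bound(1)[OF a, of _ b] and e = compensated_band_exp_bound(2)[OF a, of _ b]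
  let ?g = "\<lambda>\<omega>. 2 * (exp (1 * compensated_band a b \<omega>) + exp (-1 * compensated_band a b \<omega>) - 2)"
  have g: "integrable M ?g" using i[of 1] i[of "-1"] by (intro integrable_mult_right Bochner_Integration.integrable_diff Bochner_Integration.integrable_add) auto
  have "(\<integral>\<^sup>+\<omega>. ennreal ((compensated_band a b \<omega>)\<^sup>2) \<partial>M) \<le> (\<integral>\<^sup>+\<omega>. ennreal (?g \<omega>) \<partial>M)"
    using square_le_exp by (intro nn_integral_mono ennreal_leI) simp
  also have "\<dots> = ennreal (\<integral>\<omega>. ?g \<omega> \<partial>M)"
    using order_trans[OF zero_le_power2 square_le_exp] by (intro nn_integral_eq_integral[OF g]) simp
  also have "(\<integral>\<omega>. ?g \<omega> \<partial>M) = 2 * ((\<integral>\<omega>. exp (1 * compensated_band a b \<omega>) \<partial>M) + (\<integral>\<omega>. exp (-1 * compensated_band a b \<omega>) \<partial>M) - 2)"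
    using i[of 1] i[of "-1"] by (simp add: prob_space)
  also have "\<dots> \<le> modulus (energy (band a b))"
    using e[of 1] e[of "-1"] by (simp add: modulus_def)
  finally show ?thesis by (simp add: ennreal_leI)
qed

definition trunc :: "real \<Rightarrow> 'w \<Rightarrow> real" where "trunc \<epsilon> = compensated_band \<epsilon> 2"

lemma trunc_measurable [measurable]: "trunc \<epsilon> \<in> borel_measurable M"
  unfolding trunc_def by measurable

lemma set_integral_tail:
  assumes "sets Q = sets \<nu>"
  shows "set_lebesgue_integral Q {\<epsilon><..} f = set_lebesgue_integral Q (band \<epsilon> 2) f"
    and "set_integrable Q {\<epsilon><..} f \<longleftrightarrow> set_integrable Q (band \<epsilon> 2) f"
proof -
  have "space Q = {0<..2}" using sets_eq_imp_space_eq[OF assms] space_nu by simp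
  then have *: "indicat_real {\<epsilon><..} x *\<^sub>R f x = indicat_real (band \<epsilon> 2) x *\<^sub>R f x" if "x \<in> space Q" for x
    using that by (auto simp: band_def indicator_def)
  show "set_lebesgue_integral Q {\<epsilon><..} f = set_lebesgue_integral Q (band \<epsilon> 2) f"
    unfolding set_lebesgue_integral_def by (intro Bochner_Integration.integral_cong * refl)
  show "set_integrable Q {\<epsilon><..} f \<longleftrightarrow> set_integrable Q (band \<epsilon> 2) f"
    unfolding set_integrable_def by (intro Bochner_Integration.integrable_cong * refl)
qed

lemma truncated_eq:
  assumes "\<omega> \<in> space M"
  shows "truncated_compensated_integral \<nu> N (\<lambda>x. x) \<epsilon> \<omega> = trunc \<epsilon> \<omega>"
  by (simp add: truncated_compensated_integral_def trunc_def compensated_band_def set_integral_tail sets_N assms)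

lemma set_integrable_N:
  assumes "0 < a"
  shows "AE \<omega> in M. set_integrable (N \<omega>) (band a b) (\<lambda>x. x)"
  using count_finite[OF band_sets band_finite[OF assms, of b]] AE_space
proof eventually_elim
  case (elim \<omega>)
  then show ?case
    by (intro set_integrable_finite[where C=2] sets_N) (auto dest: band_bounds)
qed

text \<open>Almost surely only, because the integrals over the two bands add up only for realisations with
  finitely many points in them.\<close>

lemma trunc_increment:
  assumes "0 < \<delta>" "\<delta> \<le> \<epsilon>"
  shows "AE \<omega> in M. trunc \<delta> \<omega> - trunc \<epsilon> \<omega> = compensated_band \<delta> \<epsilon> \<omega>"
proof -
  have "0 < \<epsilon>" using assms by simp
  have un: "band \<delta> 2 = band \<delta> \<epsilon> \<union> band \<epsilon> 2" and int: "band \<delta> \<epsilon> \<inter> band \<epsilon> 2 = {}"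
    using assms by (auto simp: band_def)
  have \<nu>: "set_integrable \<nu> (band \<delta> \<epsilon>) (\<lambda>x. x)" "set_integrable \<nu> (band \<epsilon> 2) (\<lambda>x. x)"
    by (rule set_integrable_band; use assms in \<open>auto intro: continuous_intros\<close>)+
  show ?thesis
    using set_integrable_N[OF \<open>0 < \<delta>\<close>, of \<epsilon>] set_integrable_N[OF \<open>0 < \<epsilon>\<close>, of 2]
  proof eventually_elim
    case (elim \<omega>)
    show ?case
      unfolding trunc_def compensated_band_def un
      by (simp add: set_integral_Un[OF int elim] set_integral_Un[OF int \<nu>])
  qed
qed

lemma trunc_increment_bound:
  assumes "0 < \<delta>" "\<delta> \<le> \<epsilon>"
  shows "(\<integral>\<^sup>+\<omega>. ennreal ((trunc \<delta> \<omega> - trunc \<epsilon> \<omega>)\<^sup>2) \<partial>M) \<le> ennreal (modulus (energy (band 0 \<epsilon>)))"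
proof -
  have "(\<integral>\<^sup>+\<omega>. ennreal ((trunc \<delta> \<omega> - trunc \<epsilon> \<omega>)\<^sup>2) \<partial>M) = (\<integral>\<^sup>+\<omega>. ennreal ((compensated_band \<delta> \<epsilon> \<omega>)\<^sup>2) \<partial>M)"
    by (rule nn_integral_cong_AE) (use trunc_increment[OF assms] in \<open>eventually_elim, simp\<close>)
  also have "\<dots> \<le> ennreal (modulus (energy (band \<delta> \<epsilon>)))"
    by (rule compensated_band_second_moment[OF assms(1)])
  also have "\<dots> \<le> ennreal (modulus (energy (band 0 \<epsilon>)))"
    using assms by (intro ennreal_leI modulus_mono energy_mono band_sets) (auto simp: band_def)
  finally show ?thesis .
qed

lemma modulus_tendsto_0: "((\<lambda>\<epsilon>. modulus (energy (band 0 \<epsilon>))) \<longlongrightarrow> 0) (at_right 0)"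
proof -
  have "((\<lambda>\<epsilon>. energy (band 0 \<epsilon>)) \<longlongrightarrow> 0) (at_right 0)"
    unfolding tendsto_at_iff_sequentially comp_apply
  proof (intro allI impI)
    fix S :: "nat \<Rightarrow> real"
    assume S: "\<forall>i. S i \<in> {0<..} - {0}" "S \<longlonglongrightarrow> 0"
    have "(\<lambda>i. energy (band 0 (S i))) \<longlonglongrightarrow> (\<integral>x. 0 \<partial>\<nu>)"
      unfolding energy_def set_lebesgue_integral_def
    proof (rule integral_dominated_convergence[OF _ _ square_integrable])
      show "AE x in \<nu>. (\<lambda>i. indicat_real (band 0 (S i)) x *\<^sub>R x\<^sup>2) \<longlonglongrightarrow> 0"
      proof (rule AE_I2)
        fix x assume "x \<in> space \<nu>"
        then have "0 < x" by (simp add: space_nu)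
        then have "\<forall>\<^sub>F i in sequentially. S i < x" using S(2) by (rule order_tendstoD(2)[rotated])
        then have "\<forall>\<^sub>F i in sequentially. indicat_real (band 0 (S i)) x *\<^sub>R x\<^sup>2 = 0"
          by eventually_elim (auto simp: band_def)
        then show "(\<lambda>i. indicat_real (band 0 (S i)) x *\<^sub>R x\<^sup>2) \<longlonglongrightarrow> 0"
          by (rule tendsto_eventually)
      qed
    qed (auto simp: indicator_def)
    then show "(\<lambda>i. energy (band 0 (S i))) \<longlonglongrightarrow> 0" by simp
  qed
  then have "((\<lambda>\<epsilon>. modulus (energy (band 0 \<epsilon>))) \<longlongrightarrow> modulus 0) (at_right 0)"
    unfolding modulus_def by (intro tendsto_intros)
  then show ?thesis by (simp add: modulus_def)
qed

text \<open>Fatou's lemma turns the bound for two truncated integrals into one for a truncated integral and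
  the limit.\<close>

lemma trunc_limit_bound:
  assumes e: "\<And>n. 0 < e n" "e \<longlonglongrightarrow> 0" and [measurable]: "X \<in> borel_measurable M"
    and lim: "AE \<omega> in M. (\<lambda>n. trunc (e n) \<omega>) \<longlonglongrightarrow> X \<omega>" and \<epsilon>: "0 < \<epsilon>"
  shows "(\<integral>\<^sup>+\<omega>. ennreal ((X \<omega> - trunc \<epsilon> \<omega>)\<^sup>2) \<partial>M) \<le> ennreal (modulus (energy (band 0 \<epsilon>)))"
proof -
  let ?u = "\<lambda>n \<omega>. ennreal ((trunc (e n) \<omega> - trunc \<epsilon> \<omega>)\<^sup>2)"
  have "(\<integral>\<^sup>+\<omega>. ennreal ((X \<omega> - trunc \<epsilon> \<omega>)\<^sup>2) \<partial>M) = (\<integral>\<^sup>+\<omega>. liminf (\<lambda>n. ?u n \<omega>) \<partial>M)"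
  proof (rule nn_integral_cong_AE, use lim in eventually_elim)
    case (elim \<omega>)
    have "(\<lambda>n. ?u n \<omega>) \<longlonglongrightarrow> ennreal ((X \<omega> - trunc \<epsilon> \<omega>)\<^sup>2)"
      by (intro tendsto_intros elim)
    then show ?case by (intro lim_imp_Liminf[symmetric]) auto
  qed
  also have "\<dots> \<le> liminf (\<lambda>n. \<integral>\<^sup>+\<omega>. ?u n \<omega> \<partial>M)"
    by (rule nn_integral_liminf) measurable
  also have "\<dots> \<le> limsup (\<lambda>n. \<integral>\<^sup>+\<omega>. ?u n \<omega> \<partial>M)" by (rule Liminf_le_Limsup) simp
  also have "\<dots> \<le> ennreal (modulus (energy (band 0 \<epsilon>)))"
  proof (rule Limsup_bounded)
    have "\<forall>\<^sub>F n in sequentially. e n < \<epsilon>" using e(2) \<epsilon> by (rule order_tendstoD(2))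
    then show "\<forall>\<^sub>F n in sequentially. (\<integral>\<^sup>+\<omega>. ?u n \<omega> \<partial>M) \<le> ennreal (modulus (energy (band 0 \<epsilon>)))"
      by eventually_elim (intro trunc_increment_bound e, simp)
  qed
  finally show ?thesis .
qed

text \<open>Almost sure convergence along one sequence of truncation levels is enough for convergence in
  \<open>L\<^sup>2\<close> along all of them, because the bound on the error depends on the level only.\<close>

lemma trunc_limit_compensated:
  assumes e: "\<And>n. 0 < e n" "e \<longlonglongrightarrow> 0" and X [measurable]: "X \<in> borel_measurable M"
    and lim: "AE \<omega> in M. (\<lambda>n. trunc (e n) \<omega>) \<longlonglongrightarrow> X \<omega>"
  shows "has_compensated_integral M \<nu> N (\<lambda>x. x) X"
proof -
  note bd = trunc_limit_bound[OF e X lim]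
  let ?T = "truncated_compensated_integral \<nu> N (\<lambda>x. x)"
  have cong: "integrable M (\<lambda>\<omega>. (X \<omega> - ?T \<epsilon> \<omega>)\<^sup>2) \<longleftrightarrow> integrable M (\<lambda>\<omega>. (X \<omega> - trunc \<epsilon> \<omega>)\<^sup>2)"
    "(LINT \<omega>|M. (X \<omega> - ?T \<epsilon> \<omega>)\<^sup>2) = (LINT \<omega>|M. (X \<omega> - trunc \<epsilon> \<omega>)\<^sup>2)" for \<epsilon>
    by (simp_all add: truncated_eq cong: Bochner_Integration.integrable_cong Bochner_Integration.integral_cong)
  have int: "integrable M (\<lambda>\<omega>. (X \<omega> - trunc \<epsilon> \<omega>)\<^sup>2)" if "0 < \<epsilon>" for \<epsilon>
    using bd[OF that] by (simp add: integrable_iff_bounded le_less_trans)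
  have mod0: "0 \<le> modulus (energy B)" for B
    using modulus_mono[OF energy_nonneg[of B]] by (simp add: modulus_def)
  have le: "(LINT \<omega>|M. (X \<omega> - trunc \<epsilon> \<omega>)\<^sup>2) \<le> modulus (energy (band 0 \<epsilon>))" if "0 < \<epsilon>" for \<epsilon>
    using bd[OF that] mod0 by (subst (asm) nn_integral_eq_integral[OF int[OF that]]) auto
  have "((\<lambda>\<epsilon>. LINT \<omega>|M. (X \<omega> - trunc \<epsilon> \<omega>)\<^sup>2) \<longlongrightarrow> 0) (at_right 0)"
  proof (rule tendsto_sandwich[OF _ _ tendsto_const modulus_tendsto_0])
    show "\<forall>\<^sub>F \<epsilon> in at_right 0. (LINT \<omega>|M. (X \<omega> - trunc \<epsilon> \<omega>)\<^sup>2) \<le> modulus (energy (band 0 \<epsilon>))"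
      using eventually_at_right_less by eventually_elim (rule le)
  qed simp
  moreover have "set_integrable \<nu> {\<epsilon><..} (\<lambda>x. x)" if "0 < \<epsilon>" for \<epsilon>
    by (simp add: set_integral_tail set_integrable_band that)
  moreover have "AE \<omega> in M. set_integrable (N \<omega>) {\<epsilon><..} (\<lambda>x. x)" if "0 < \<epsilon>" for \<epsilon>
    using set_integrable_N[OF that, of 2] AE_space
    by eventually_elim (simp add: set_integral_tail sets_N)
  moreover have "?T \<epsilon> \<in> borel_measurable M" for \<epsilon>
    by (simp add: truncated_eq cong: measurable_cong)
  ultimately show ?thesis
    unfolding has_compensated_integral_def cong using X int by blast
qed

text \<open>Two limits in \<open>L\<^sup>2\<close> of the same truncated integrals; this allows the law to be computed for one
  particular version.\<close>

lemma compensated_AE_unique: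
  assumes "has_compensated_integral M \<nu> N (\<lambda>x. x) X" "has_compensated_integral M \<nu> N (\<lambda>x. x) Y"
  shows "AE \<omega> in M. X \<omega> = Y \<omega>"
proof -
  let ?T = "truncated_compensated_integral \<nu> N (\<lambda>x. x)"
  have [measurable]: "X \<in> borel_measurable M" "Y \<in> borel_measurable M"
    using assms by (auto simp: has_compensated_integral_def)
  let ?b = "\<lambda>\<epsilon>. 2 * (LINT \<omega>|M. (X \<omega> - ?T \<epsilon> \<omega>)\<^sup>2) + 2 * (LINT \<omega>|M. (Y \<omega> - ?T \<epsilon> \<omega>)\<^sup>2)"
  have le: "(\<integral>\<^sup>+\<omega>. ennreal ((X \<omega> - Y \<omega>)\<^sup>2) \<partial>M) \<le> ennreal (?b \<epsilon>)" if "0 < \<epsilon>" for \<epsilon>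
  proof -
    have i: "integrable M (\<lambda>\<omega>. (X \<omega> - ?T \<epsilon> \<omega>)\<^sup>2)" "integrable M (\<lambda>\<omega>. (Y \<omega> - ?T \<epsilon> \<omega>)\<^sup>2)"
      using assms that by (auto simp: has_compensated_integral_def)
    have "(\<integral>\<^sup>+\<omega>. ennreal ((X \<omega> - Y \<omega>)\<^sup>2) \<partial>M)
      \<le> (\<integral>\<^sup>+\<omega>. ennreal (2 * (X \<omega> - ?T \<epsilon> \<omega>)\<^sup>2 + 2 * (Y \<omega> - ?T \<epsilon> \<omega>)\<^sup>2) \<partial>M)"
    proof (intro nn_integral_mono ennreal_leI)
      fix \<omega>
      have "0 \<le> ((X \<omega> - ?T \<epsilon> \<omega>) + (Y \<omega> - ?T \<epsilon> \<omega>))\<^sup>2" by simp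
      then show "(X \<omega> - Y \<omega>)\<^sup>2 \<le> 2 * (X \<omega> - ?T \<epsilon> \<omega>)\<^sup>2 + 2 * (Y \<omega> - ?T \<epsilon> \<omega>)\<^sup>2"
        by (simp add: power2_eq_square algebra_simps)
    qed
    also have "\<dots> = ennreal (\<integral>\<omega>. 2 * (X \<omega> - ?T \<epsilon> \<omega>)\<^sup>2 + 2 * (Y \<omega> - ?T \<epsilon> \<omega>)\<^sup>2 \<partial>M)"
      using i by (intro nn_integral_eq_integral) auto
    also have "(\<integral>\<omega>. 2 * (X \<omega> - ?T \<epsilon> \<omega>)\<^sup>2 + 2 * (Y \<omega> - ?T \<epsilon> \<omega>)\<^sup>2 \<partial>M) = ?b \<epsilon>"
      using i by simp
    finally show ?thesis .
  qed
  have "(?b \<longlongrightarrow> 2 * 0 + 2 * 0) (at_right 0)"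
    using assms by (intro tendsto_intros) (auto simp: has_compensated_integral_def)
  then have "((\<lambda>\<epsilon>. ennreal (?b \<epsilon>)) \<longlongrightarrow> ennreal 0) (at_right 0)"
    by (intro tendsto_ennrealI) simp
  then have "(\<integral>\<^sup>+\<omega>. ennreal ((X \<omega> - Y \<omega>)\<^sup>2) \<partial>M) \<le> ennreal 0"
  proof (rule tendsto_lowerbound)
    show "\<forall>\<^sub>F \<epsilon> in at_right 0. (\<integral>\<^sup>+\<omega>. ennreal ((X \<omega> - Y \<omega>)\<^sup>2) \<partial>M) \<le> ennreal (?b \<epsilon>)"
      using eventually_at_right_less by eventually_elim (rule le)
  qed simp
  then have "(\<integral>\<^sup>+\<omega>. ennreal ((X \<omega> - Y \<omega>)\<^sup>2) \<partial>M) = 0" by simp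
  then show ?thesis by (subst (asm) nn_integral_0_iff_AE) auto
qed

text \<open>Stated for any measure \<open>Q\<close> on \<open>(0, 2]\<close>: it serves for \<open>\<nu>\<close> and for the realisations of the process.\<close>

lemma band_exhausts:
  fixes f :: "real \<Rightarrow> 'c :: {banach, second_countable_topology}"
  assumes e: "\<And>n. 0 < e n" "e \<longlonglongrightarrow> 0" and Q: "sets Q = sets \<nu>" and f: "integrable Q f"
  shows "(\<lambda>n. set_lebesgue_integral Q (band (e n) 2) f) \<longlonglongrightarrow> (\<integral>x. f x \<partial>Q)"
  unfolding set_lebesgue_integral_def
proof (rule integral_dominated_convergence[OF _ _ integrable_norm[OF f]])
  have [measurable]: "band a b \<in> sets Q" for a b using Q by simp
  note borel_measurable_integrable[OF f, measurable]
  show "(\<lambda>x. indicat_real (band (e n) 2) x *\<^sub>R f x) \<in> borel_measurable Q" for n by measurable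
  show "AE x in Q. (\<lambda>n. indicat_real (band (e n) 2) x *\<^sub>R f x) \<longlonglongrightarrow> f x"
  proof (rule AE_I2)
    fix x assume "x \<in> space Q"
    then have x: "0 < x" "x \<le> 2" using sets_eq_imp_space_eq[OF Q] by (auto simp: space_nu)
    have "\<forall>\<^sub>F n in sequentially. e n < x" using e(2) x(1) by (rule order_tendstoD(2))
    then have "\<forall>\<^sub>F n in sequentially. indicat_real (band (e n) 2) x *\<^sub>R f x = f x"
      by eventually_elim (use x in \<open>auto simp: band_def\<close>)
    then show "(\<lambda>n. indicat_real (band (e n) 2) x *\<^sub>R f x) \<longlonglongrightarrow> f x"
      by (rule tendsto_eventually)
  qed
qed (use f in \<open>auto simp: indicator_def\<close>)

text \<open>Truncation levels that decrease so fast that the increments of the truncated integrals have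
  \<open>L\<^sup>1\<close> norms bounded by a geometric series; then the increments are almost surely summable.\<close>

lemma compensated_approximation:
  obtains e :: "nat \<Rightarrow> real" and X where "\<And>n. 0 < e n" "e \<longlonglongrightarrow> 0" "X \<in> borel_measurable M"
    "AE \<omega> in M. (\<lambda>n. trunc (e n) \<omega>) \<longlonglongrightarrow> X \<omega>"
proof -
  let ?r = "\<lambda>\<epsilon>. modulus (energy (band 0 \<epsilon>))"
  have step: "\<exists>y. (0 < y \<and> y \<le> 1 / real (Suc n) \<and> ?r y \<le> (1 / 4) ^ n) \<and> y \<le> x" if "0 < x" for n and x :: real
  proof -
    have "\<forall>\<^sub>F y in at_right 0. ?r y < (1 / 4) ^ n"
      by (rule order_tendstoD(2)[OF modulus_tendsto_0]) simp
    moreover have "\<forall>\<^sub>F y in at_right 0. y \<in> {0<..<min x (1 / real (Suc n))}"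
      by (rule eventually_at_right_real) (use that in auto)
    ultimately have "\<forall>\<^sub>F y in at_right 0. (0 < y \<and> y \<le> 1 / real (Suc n) \<and> ?r y \<le> (1 / 4) ^ n) \<and> y \<le> x"
      by eventually_elim auto
    then show ?thesis by (rule eventually_happens'[OF trivial_limit_at_right_real])
  qed
  have "\<exists>e. \<forall>n. (0 < e n \<and> e n \<le> 1 / real (Suc n) \<and> ?r (e n) \<le> (1 / 4) ^ n) \<and> e (Suc n) \<le> e n"
  proof (rule dependent_nat_choice)
    show "\<exists>x. 0 < x \<and> x \<le> 1 / real (Suc 0) \<and> ?r x \<le> (1 / 4) ^ 0"
      using step[of 1 0] by auto
    show "\<exists>y. (0 < y \<and> y \<le> 1 / real (Suc (Suc n)) \<and> ?r y \<le> (1 / 4) ^ Suc n) \<and> y \<le> x"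
      if "0 < x \<and> x \<le> 1 / real (Suc n) \<and> ?r x \<le> (1 / 4) ^ n" for x n
      using step[of x "Suc n"] that by auto
  qed
  then obtain e where e: "\<And>n. 0 < e n" "\<And>n. e n \<le> 1 / real (Suc n)" "\<And>n. ?r (e n) \<le> (1 / 4) ^ n"
    "\<And>n. e (Suc n) \<le> e n" by blast
  have e0: "e \<longlonglongrightarrow> 0"
    by (rule tendsto_sandwich[OF _ _ tendsto_const LIMSEQ_inverse_real_of_nat])
       (use e(1,2) in \<open>auto simp: less_imp_le divide_inverse\<close>)
  let ?d = "\<lambda>n \<omega>. trunc (e (Suc n)) \<omega> - trunc (e n) \<omega>"
  have L1: "(\<integral>\<^sup>+\<omega>. ennreal \<bar>?d n \<omega>\<bar> \<partial>M) \<le> ennreal ((1 / 2) ^ n)" for n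
  proof -
    have "(\<integral>\<^sup>+\<omega>. ennreal \<bar>?d n \<omega>\<bar> \<partial>M)
      \<le> (\<integral>\<^sup>+\<omega>. ennreal (2 ^ n / 2) * ennreal ((?d n \<omega>)\<^sup>2) + ennreal ((1 / 2) ^ n / 2) \<partial>M)"
    proof (rule nn_integral_mono)
      fix \<omega>
      (* Young's inequality with weight 2^n turns the bound 4^-n on the second moment into the bound
         2^-n on the first. *)
      have "2 * y \<le> a * y\<^sup>2 + 1 / a" if "0 < a" for a y :: real
      proof -
        have "0 \<le> (a * y - 1)\<^sup>2 / a" using that by simp
        also have "\<dots> = a * y\<^sup>2 + 1 / a - 2 * y"
          using that by (simp add: power2_eq_square field_simps)
        finally show ?thesis by simp
      qed
      from this[of "2 ^ n" "\<bar>?d n \<omega>\<bar>"] have "\<bar>?d n \<omega>\<bar> \<le> 2 ^ n / 2 * (?d n \<omega>)\<^sup>2 + (1 / 2) ^ n / 2" by (simp add: power_one_over)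
      then have "ennreal \<bar>?d n \<omega>\<bar> \<le> ennreal (2 ^ n / 2 * (?d n \<omega>)\<^sup>2 + (1 / 2) ^ n / 2)" by (rule ennreal_leI)
      also have "\<dots> = ennreal (2 ^ n / 2) * ennreal ((?d n \<omega>)\<^sup>2) + ennreal ((1 / 2) ^ n / 2)"
        by (subst ennreal_plus) (auto simp: ennreal_mult[symmetric])
      finally show "ennreal \<bar>?d n \<omega>\<bar> \<le> ennreal (2 ^ n / 2) * ennreal ((?d n \<omega>)\<^sup>2) + ennreal ((1 / 2) ^ n / 2)" .
    qed
    also have "\<dots> = ennreal (2 ^ n / 2) * (\<integral>\<^sup>+\<omega>. ennreal ((?d n \<omega>)\<^sup>2) \<partial>M) + ennreal ((1 / 2) ^ n / 2)"
      by (simp add: nn_integral_add nn_integral_cmult emeasure_space_1)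
    also have "\<dots> \<le> ennreal (2 ^ n / 2) * ennreal ((1 / 4) ^ n) + ennreal ((1 / 2) ^ n / 2)"
      by (intro add_mono mult_left_mono order_refl order_trans[OF trunc_increment_bound] ennreal_leI e) auto
    also have "\<dots> = ennreal ((1 / 2) ^ n)"
    proof -
      have "2 ^ n / 2 * (1 / 4) ^ n + (1 / 2) ^ n / 2 = (1 / 2 :: real) ^ n"
      proof -
        have "2 ^ n * (1 / 4) ^ n = (1 / 2 :: real) ^ n" by (simp flip: power_mult_distrib)
        then show ?thesis by simp
      qed
      then show ?thesis by (simp flip: ennreal_plus ennreal_mult)
    qed
    finally show ?thesis .
  qed
  have "(\<integral>\<^sup>+\<omega>. (\<Sum>n. ennreal \<bar>?d n \<omega>\<bar>) \<partial>M) = (\<Sum>n. \<integral>\<^sup>+\<omega>. ennreal \<bar>?d n \<omega>\<bar> \<partial>M)"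
    by (rule nn_integral_suminf) measurable
  also have "\<dots> \<le> (\<Sum>n. ennreal ((1 / 2) ^ n))" by (intro suminf_le L1 summableI)
  also have "\<dots> = ennreal 2"
    using power_half_series by (intro suminf_ennreal_eq) (auto simp: sums_iff suminf_geometric)
  finally have fin: "(\<integral>\<^sup>+\<omega>. (\<Sum>n. ennreal \<bar>?d n \<omega>\<bar>) \<partial>M) \<noteq> \<infinity>" by (auto simp: top_unique)
  have "AE \<omega> in M. (\<Sum>n. ennreal \<bar>?d n \<omega>\<bar>) \<noteq> \<infinity>"
    by (rule nn_integral_PInf_AE[OF _ fin]) measurable
  then have "AE \<omega> in M. (\<lambda>n. trunc (e n) \<omega>) \<longlonglongrightarrow> lim (\<lambda>n. trunc (e n) \<omega>)"
  proof eventually_elim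
    case (elim \<omega>)
    then have "summable (\<lambda>n. \<bar>?d n \<omega>\<bar>)" by (intro summable_suminf_not_top) auto
    then have "summable (\<lambda>n. ?d n \<omega>)" by (rule summable_rabs_cancel)
    then have "convergent (\<lambda>n. \<Sum>i<n. ?d i \<omega>)" by (simp add: summable_iff_convergent)
    then have "convergent (\<lambda>n. trunc (e n) \<omega> - trunc (e 0) \<omega>)"
      by (simp only: sum_lessThan_telescope[of "\<lambda>n. trunc (e n) \<omega>"])
    then have "convergent (\<lambda>n. trunc (e n) \<omega>)"
      by (subst (asm) diff_conv_add_uminus) (simp only: convergent_add_const_right_iff)
    then show ?case by (simp add: convergent_LIMSEQ_iff)
  qed
  moreover have "(\<lambda>\<omega>. lim (\<lambda>n. trunc (e n) \<omega>)) \<in> borel_measurable M" by measurable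
  ultimately show ?thesis using that e(1) e0 by blast
qed

lemma compensated_exists: "\<exists>X. has_compensated_integral M \<nu> N (\<lambda>x. x) X"
  by (rule compensated_approximation) (rule exI, rule trunc_limit_compensated)

lemma compensated_is_limit:
  obtains e where "\<And>n. 0 < e n" "e \<longlonglongrightarrow> 0"
    "\<And>X. has_compensated_integral M \<nu> N (\<lambda>x. x) X \<Longrightarrow> AE \<omega> in M. (\<lambda>n. trunc (e n) \<omega>) \<longlonglongrightarrow> X \<omega>"
proof -
  obtain e Y where e: "\<And>n. 0 < e n" "e \<longlonglongrightarrow> 0" and Y: "Y \<in> borel_measurable M"
    "AE \<omega> in M. (\<lambda>n. trunc (e n) \<omega>) \<longlonglongrightarrow> Y \<omega>"
    using compensated_approximation by metis
  have "AE \<omega> in M. (\<lambda>n. trunc (e n) \<omega>) \<longlonglongrightarrow> X \<omega>" if "has_compensated_integral M \<nu> N (\<lambda>x. x) X" for X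
    using Y(2) compensated_AE_unique[OF that trunc_limit_compensated[OF e Y]]
    by eventually_elim simp
  with e show ?thesis using that by blast
qed

section \<open>Exponential moments and characteristic function of the compensated integral\<close>

context
  fixes X assumes X: "has_compensated_integral M \<nu> N (\<lambda>x. x) X"
begin

lemma compensated_measurable [measurable]: "X \<in> borel_measurable M"
  using X by (simp add: has_compensated_integral_def)

text \<open>The exponential moments of the truncated integrals are bounded uniformly in the level, and the
  bound passes to the limit by Fatou's lemma.\<close>

lemma compensated_exp_integrable: "integrable M (\<lambda>\<omega>. exp (t * X \<omega>))"
proof -
  obtain e where e: "\<And>n. 0 < e n" "e \<longlonglongrightarrow> 0"
    and e_lim: "\<And>Y. has_compensated_integral M \<nu> N (\<lambda>x. x) Y \<Longrightarrow> AE \<omega> in M. (\<lambda>n. trunc (e n) \<omega>) \<longlonglongrightarrow> Y \<omega>"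
    by (rule compensated_is_limit) blast
  note lim = e_lim[OF X]
  let ?u = "\<lambda>n \<omega>. ennreal (exp (t * trunc (e n) \<omega>))"
  let ?C = "exp (t\<^sup>2 * exp (2 * \<bar>t\<bar>) * energy (band 0 2))"
  have "(\<integral>\<^sup>+\<omega>. ennreal (exp (t * X \<omega>)) \<partial>M) = (\<integral>\<^sup>+\<omega>. liminf (\<lambda>n. ?u n \<omega>) \<partial>M)"
  proof (rule nn_integral_cong_AE, use lim in eventually_elim)
    case (elim \<omega>)
    have "(\<lambda>n. ?u n \<omega>) \<longlonglongrightarrow> ennreal (exp (t * X \<omega>))"
      by (intro tendsto_intros elim)
    then show ?case by (intro lim_imp_Liminf[symmetric]) auto
  qed
  also have "\<dots> \<le> liminf (\<lambda>n. \<integral>\<^sup>+\<omega>. ?u n \<omega> \<partial>M)"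
    by (rule nn_integral_liminf) measurable
  also have "\<dots> \<le> limsup (\<lambda>n. \<integral>\<^sup>+\<omega>. ?u n \<omega> \<partial>M)" by (rule Liminf_le_Limsup) simp
  also have "\<dots> \<le> ennreal ?C"
  proof (rule Limsup_bounded, rule always_eventually, rule allI)
    fix n
    have "(\<integral>\<^sup>+\<omega>. ?u n \<omega> \<partial>M) = ennreal (\<integral>\<omega>. exp (t * trunc (e n) \<omega>) \<partial>M)"
      unfolding trunc_def by (intro nn_integral_eq_integral compensated_band_exp_bound e) simp
    also have "\<dots> \<le> ennreal (exp (t\<^sup>2 * exp (2 * \<bar>t\<bar>) * energy (band (e n) 2)))"
      unfolding trunc_def by (intro ennreal_leI compensated_band_exp_bound e)
    also have "\<dots> \<le> ennreal ?C"
      using e(1)[of n] by (intro ennreal_leI iffD2[OF exp_le_cancel_iff] mult_left_mono energy_mono band_sets)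
        (auto simp: band_def)
    finally show "(\<integral>\<^sup>+\<omega>. ?u n \<omega> \<partial>M) \<le> ennreal ?C" .
  qed
  finally show ?thesis by (simp add: integrable_iff_bounded le_less_trans)
qed

lemma compensated_char:
  "char (distr M borel X) t = exp (\<integral>x. exp (\<i> * t * of_real x) - 1 - \<i> * t * of_real x \<partial>\<nu>)"
proof -
  obtain e where e: "\<And>n. 0 < e n" "e \<longlonglongrightarrow> 0"
    and e_lim: "\<And>Y. has_compensated_integral M \<nu> N (\<lambda>x. x) Y \<Longrightarrow> AE \<omega> in M. (\<lambda>n. trunc (e n) \<omega>) \<longlonglongrightarrow> Y \<omega>"
    by (rule compensated_is_limit) blast
  note lim = e_lim[OF X]
  let ?z = "\<i> * complex_of_real t"
  let ?f = "\<lambda>x. exp (?z * of_real x) - 1 - ?z * of_real x"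
  have f: "integrable \<nu> ?f"
  proof -
    have "integrable \<nu> ?f \<longleftrightarrow> integrable \<nu> (\<lambda>x. indicat_real (space \<nu>) x *\<^sub>R ?f x)"
      by (rule Bochner_Integration.integrable_cong) auto
    then show ?thesis
      using cumulant_integrable(1)[OF sets.top, of ?z] by (simp add: set_integrable_def)
  qed
  have 1: "(\<lambda>n. \<integral>\<omega>. exp (?z * of_real (trunc (e n) \<omega>)) \<partial>M) \<longlonglongrightarrow> (\<integral>\<omega>. exp (?z * of_real (X \<omega>)) \<partial>M)"
  proof (rule integral_dominated_convergence[where w="\<lambda>_. 1"])
    show "AE \<omega> in M. (\<lambda>n. exp (?z * of_real (trunc (e n) \<omega>))) \<longlonglongrightarrow> exp (?z * of_real (X \<omega>))"
      using lim by eventually_elim (intro tendsto_intros)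
  qed auto
  have "(\<lambda>n. set_lebesgue_integral \<nu> (band (e n) 2) ?f) \<longlonglongrightarrow> (\<integral>x. ?f x \<partial>\<nu>)"
    by (rule band_exhausts[OF e refl f])
  then have 2: "(\<lambda>n. \<integral>\<omega>. exp (?z * of_real (trunc (e n) \<omega>)) \<partial>M) \<longlonglongrightarrow> exp (\<integral>x. ?f x \<partial>\<nu>)"
    unfolding trunc_def compensated_band_mgf(2)[OF e(1)] by (rule tendsto_exp)
  have "char (distr M borel X) t = (\<integral>\<omega>. exp (?z * of_real (X \<omega>)) \<partial>M)"
    by (simp add: char_def integral_distr mult.assoc)
  then show ?thesis using LIMSEQ_unique[OF 1 2] by (simp add: mult.assoc)
qed

end

lemma power_le_square:
  assumes "x \<in> space \<nu>" "2 \<le> m" shows "x ^ m \<le> 2 ^ m * x\<^sup>2"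
proof -
  have x: "0 < x" "x \<le> 2" using assms by (auto simp: space_nu)
  have "x ^ m = x ^ (m - 2) * x\<^sup>2" using assms(2) by (metis le_add_diff_inverse2 power_add)
  also have "\<dots> \<le> 2 ^ m * x\<^sup>2"
    using x by (intro mult_right_mono order_trans[OF power_mono[of x 2]] power_increasing) auto
  finally show ?thesis .
qed

lemma power_integrable:
  assumes "2 \<le> m" shows "integrable \<nu> (\<lambda>x. x ^ m)"
proof (rule Bochner_Integration.integrable_bound[OF integrable_mult_right[OF square_integrable, of "2 ^ m"]])
  show "AE x in \<nu>. norm (x ^ m) \<le> norm (2 ^ m * x\<^sup>2)"
  proof (rule AE_I2)
    fix x assume "x \<in> space \<nu>"
    then show "norm (x ^ m) \<le> norm (2 ^ m * x\<^sup>2)"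
      using power_le_square[OF _ assms, of x] by (simp add: space_nu)
  qed
qed measurable

text \<open>The exponent of the characteristic function is the cumulant generating function: its derivatives
  at \<open>0\<close> are the moments of \<open>\<nu>\<close>, except that compensation removes the first.\<close>

lemma cumulant_series:
  fixes z :: complex
  shows "(\<lambda>m. (if 2 \<le> m then of_real ((\<integral>x. x ^ m \<partial>\<nu>) / fact m) else 0) * z ^ m)
    sums (\<integral>x. exp (z * of_real x) - 1 - z * of_real x \<partial>\<nu>)"
proof -
  let ?g = "\<lambda>m x. (if 2 \<le> m then (z * complex_of_real x) ^ m /\<^sub>R fact m else 0)"
  have g: "?g m = (\<lambda>x. if 2 \<le> m then (z ^ m / fact m) * complex_of_real (x ^ m) else 0)" for m
    by (auto simp: power_mult_distrib scaleR_conv_of_real field_simps)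
  have int: "integrable \<nu> (?g m)" for m
  proof (cases "2 \<le> m")
    case True
    have "integrable \<nu> (\<lambda>x. (z ^ m / fact m) * complex_of_real (x ^ m))"
      by (intro integrable_mult_right integrable_of_real power_integrable True)
    then show ?thesis unfolding g using True by simp
  qed (simp add: g)
  have Ig: "(\<integral>x. ?g m x \<partial>\<nu>) = (if 2 \<le> m then of_real ((\<integral>x. x ^ m \<partial>\<nu>) / fact m) else 0) * z ^ m" for m
    using integral_complex_of_real[of \<nu> "\<lambda>x. x ^ m"] unfolding g
    by (cases "2 \<le> m") (auto simp del: of_real_power integral_complex_of_real)
  have c: "summable (\<lambda>m. (2 * norm z) ^ m /\<^sub>R fact m * C)" for C :: real
    by (intro summable_mult2 summable_exp_generic)
  have ng: "norm (?g m x) \<le> (2 * norm z) ^ m /\<^sub>R fact m * x\<^sup>2" if "x \<in> space \<nu>" for m x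
  proof (cases "2 \<le> m")
    case True
    have "norm (?g m x) = norm z ^ m /\<^sub>R fact m * x ^ m"
      using True that by (simp add: norm_mult norm_power space_nu power_mult_distrib)
    also have "\<dots> \<le> norm z ^ m /\<^sub>R fact m * (2 ^ m * x\<^sup>2)"
      by (intro mult_left_mono power_le_square that True) auto
    finally show ?thesis by (simp add: power_mult_distrib mult_ac)
  qed auto
  have sums: "(\<lambda>m. ?g m x) sums (exp (z * of_real x) - 1 - z * of_real x)" for x
  proof -
    have "(\<lambda>m. (z * of_real x) ^ (m + 2) /\<^sub>R fact (m + 2)) sums (exp (z * of_real x) - (\<Sum>m<2. (z * of_real x) ^ m /\<^sub>R fact m))"
      by (rule sums_split_initial_segment[OF exp_converges])
    then have "(\<lambda>m. ?g (m + 2) x) sums (exp (z * of_real x) - 1 - z * of_real x - (\<Sum>m<2. ?g m x))"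
      by (simp add: numeral_2_eq_2 algebra_simps)
    then show ?thesis by (subst (asm) sums_iff_shift) simp
  qed
  have "(\<lambda>m. \<integral>x. ?g m x \<partial>\<nu>) sums (\<integral>x. (\<Sum>m. ?g m x) \<partial>\<nu>)"
  proof (rule sums_integral[OF int])
    show "AE x in \<nu>. summable (\<lambda>m. norm (?g m x))"
    proof (rule AE_I2)
      fix x assume x: "x \<in> space \<nu>"
      show "summable (\<lambda>m. norm (?g m x))"
        by (rule summable_comparison_test'[OF c[of "x\<^sup>2"], of 0])
           (simp only: real_norm_def abs_norm_cancel ng[OF x])
    qed
    show "summable (\<lambda>m. \<integral>x. norm (?g m x) \<partial>\<nu>)"
    proof (rule summable_comparison_test'[OF c])
      fix m
      have "(\<integral>x. norm (?g m x) \<partial>\<nu>) \<le> (\<integral>x. (2 * norm z) ^ m /\<^sub>R fact m * x\<^sup>2 \<partial>\<nu>)"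
        by (intro integral_mono integrable_norm int integrable_mult_right square_integrable ng)
      then show "norm (\<integral>x. norm (?g m x) \<partial>\<nu>) \<le> (2 * norm z) ^ m /\<^sub>R fact m * (\<integral>x. x\<^sup>2 \<partial>\<nu>)"
        by simp
    qed
  qed
  then show ?thesis unfolding Ig using sums by (simp add: sums_iff)
qed

end

section \<open>Laws determined by their cumulants\<close>

definition cumulant :: "real \<Rightarrow> real \<Rightarrow> nat \<Rightarrow> real" where
  "cumulant \<alpha> c m = c\<^sup>2 * 2 ^ (m - 1) * (c_coeff \<alpha> m)\<^sup>2"

text \<open>The cumulant generating function of a centred variable: the coefficients of degree \<open>0\<close> and \<open>1\<close> are \<open>0\<close>.\<close>

definition cumulant_fps :: "(nat \<Rightarrow> real) \<Rightarrow> complex fps" where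
  "cumulant_fps \<kappa> = Abs_fps (\<lambda>m. if 2 \<le> m then of_real (\<kappa> m / fact m) else 0)"

lemma tuples_ge2_length_bound: "m \<in> tuples_ge2 v s \<Longrightarrow> 2 * v \<le> s"
proof -
  assume m: "m \<in> tuples_ge2 v s"
  have "(\<Sum>k\<leftarrow>m. 2) \<le> (\<Sum>k\<leftarrow>m. k)"
    using m by (intro sum_list_mono) (auto simp: tuples_ge2_def)
  then show ?thesis using m by (simp add: tuples_ge2_def sum_list_triv)
qed

lemma cumulant_tuple_product:
  assumes m: "m \<in> tuples_ge2 v s"
  shows "(\<Prod>l<v. cumulant \<alpha> c (m ! l) / fact (m ! l))
    = c ^ (2 * v) * 2 ^ (s - v) * ((1 / (\<Prod>l<v. fact (m ! l))) * (\<Prod>l<v. (c_coeff \<alpha> (m ! l))\<^sup>2))"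
proof -
  have len: "length m = v" and ge: "\<And>l. l < v \<Longrightarrow> 2 \<le> m ! l" and sum: "sum_list m = s"
    using m by (auto simp: tuples_ge2_def)
  have "(\<Sum>l<v. m ! l - 1) = (\<Sum>l<v. m ! l) - (\<Sum>l<v. 1)"
    by (rule sum_subtractf_nat) (use ge in \<open>force intro: order_trans[of _ 2]\<close>)
  also have "\<dots> = s - v"
    using sum len by (simp add: sum_list_sum_nth atLeast0LessThan)
  finally have "(\<Prod>l<v. (2::real) ^ (m ! l - 1)) = 2 ^ (s - v)" by (simp add: power_sum[symmetric])
  then show ?thesis
    by (simp add: cumulant_def prod_dividef prod.distrib power_mult)
qed

text \<open>Expanding \<open>exp K = (\<Sum>v. K ^ v / v!)\<close>, where the coefficient of degree \<open>s\<close> in \<open>K ^ v\<close> is a sum over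
  the \<open>v\<close>-tuples of sum \<open>s\<close>. As \<open>K\<close> begins in degree \<open>2\<close>, only tuples with entries at least
  \<open>2\<close>, and hence only \<open>v \<le> s div 2\<close>, contribute. The degree \<open>0\<close> is excluded: there the power series has the
  coefficient \<open>1\<close>, while the sum that defines \<^const>\<open>eta_moment\<close> is empty.\<close>

lemma eta_moment_eq_fps:
  assumes s: "1 \<le> s"
  shows "fps_nth (fps_exp 1 oo cumulant_fps (cumulant \<alpha> c)) s = of_real (eta_moment \<alpha> c s / fact s)"
proof -
  let ?K = "cumulant_fps (cumulant \<alpha> c)"
  let ?p = "\<lambda>i m. \<Prod>l<i. cumulant \<alpha> c (m ! l) / fact (m ! l)"
  have K: "fps_nth (?K ^ i) s = of_real (\<Sum>m\<in>tuples_ge2 i s. ?p i m)" if i: "1 \<le> i" for i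
  proof -
    have "fps_nth (?K ^ i) s = (\<Sum>m\<in>natpermute s i. \<Prod>l<i. fps_nth ?K (m ! l))"
      using i by (simp add: fps_power_nth atLeast0AtMost lessThan_Suc_atMost[symmetric])
    also have "\<dots> = (\<Sum>m\<in>tuples_ge2 i s. \<Prod>l<i. fps_nth ?K (m ! l))"
    proof (rule sum.mono_neutral_right)
      show "finite (natpermute s i)" by (rule natpermute_finite)
      show "tuples_ge2 i s \<subseteq> natpermute s i"
        by (auto simp: tuples_ge2_def natpermute_def)
      show "\<forall>m\<in>natpermute s i - tuples_ge2 i s. (\<Prod>l<i. fps_nth ?K (m ! l)) = 0"
        by (auto simp: tuples_ge2_def natpermute_def cumulant_fps_def in_set_conv_nth)
    qed
    also have "\<dots> = (\<Sum>m\<in>tuples_ge2 i s. of_real (?p i m))"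
      unfolding of_real_prod
      by (intro sum.cong prod.cong refl) (auto simp: tuples_ge2_def cumulant_fps_def)
    finally show ?thesis by simp
  qed
  have "fps_nth (fps_exp 1 oo ?K) s = (\<Sum>i=0..s. (1 / fact i) * fps_nth (?K ^ i) s)"
    by (simp add: fps_compose_nth)
  also have "\<dots> = (\<Sum>i=1..s div 2. (1 / fact i) * fps_nth (?K ^ i) s)"
  proof (rule sum.mono_neutral_right)
    show "\<forall>i\<in>{0..s} - {1..s div 2}. (1 / fact i) * fps_nth (?K ^ i) s = 0"
    proof
      fix i assume i: "i \<in> {0..s} - {1..s div 2}"
      show "(1 / fact i) * fps_nth (?K ^ i) s = 0"
      proof (cases "i = 0")
        case False
        then have "tuples_ge2 i s = {}" using i tuples_ge2_length_bound[of _ i s] by fastforce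
        then show ?thesis using False by (simp add: K)
      qed (use s in simp)
    qed
  qed auto
  also have "\<dots> = of_real (\<Sum>i=1..s div 2. (1 / fact i) * (\<Sum>m\<in>tuples_ge2 i s. ?p i m))"
    by (simp add: K)
  also have "(\<Sum>i=1..s div 2. (1 / fact i) * (\<Sum>m\<in>tuples_ge2 i s. ?p i m)) = eta_moment \<alpha> c s / fact s"
    by (simp add: eta_moment_def sum_divide_distrib sum_distrib_left cumulant_tuple_product
        cong: sum.cong) (simp add: mult_ac)
  finally show ?thesis .
qed

text \<open>The composition is the Taylor series at \<open>0\<close> of an entire function, so it converges everywhere.\<close>

lemma exp_compose_sums:
  fixes K :: "complex fps"
  assumes K0: "fps_nth K 0 = 0" and k: "\<And>z. (\<lambda>m. fps_nth K m * z ^ m) sums k z"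
  shows "(\<lambda>s. fps_nth (fps_exp 1 oo K) s * z ^ s) sums exp (k z)"
proof -
  have rad: "fps_conv_radius K = \<infinity>"
    unfolding fps_conv_radius_def using k by (intro conv_radius_inftyI'') (auto simp: sums_iff)
  have k_eq: "k = eval_fps K"
    using k by (auto simp: eval_fps_def sums_iff fun_eq_iff)
  have "k has_fps_expansion K"
    by (simp add: has_fps_expansion_def rad k_eq)
  then have "(exp \<circ> k) has_fps_expansion (fps_exp 1 oo K)"
    using has_fps_expansion_exp[of "1::complex"] K0 by (intro has_fps_expansion_compose) simp_all
  moreover have "(exp \<circ> k) holomorphic_on eball 0 \<infinity>"
    unfolding k_eq comp_def by (intro holomorphic_intros) (simp add: rad)
  ultimately have "(\<lambda>s. fps_nth (fps_exp 1 oo K) s * z ^ s) sums (exp \<circ> k) z"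
    by (rule has_fps_expansion_imp_sums_complex) simp
  then show ?thesis by simp
qed

text \<open>Even partial sums are used because the error of the Taylor approximation of order \<open>2 * n\<close> involves
  the absolute moment of that order, which is then an ordinary moment.\<close>

lemma (in real_distribution) char_moment_limit:
  assumes int: "\<And>k. integrable M (\<lambda>x. x ^ k)"
    and small: "(\<lambda>n. \<bar>t\<bar> ^ (2 * n) / fact (2 * n) * expectation (\<lambda>x. x ^ (2 * n))) \<longlonglongrightarrow> 0"
  shows "(\<lambda>n. \<Sum>k\<le>2 * n. (\<i> * t) ^ k / fact k * expectation (\<lambda>x. x ^ k)) \<longlonglongrightarrow> char M t"
proof -
  have "(\<lambda>n. char M t - (\<Sum>k\<le>2 * n. (\<i> * t) ^ k / fact k * expectation (\<lambda>x. x ^ k))) \<longlonglongrightarrow> 0"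
  proof (rule Lim_null_comparison)
    show "(\<lambda>n. 2 * (\<bar>t\<bar> ^ (2 * n) / fact (2 * n) * expectation (\<lambda>x. x ^ (2 * n)))) \<longlonglongrightarrow> 0"
      using tendsto_mult_right_zero[OF small] .
    show "\<forall>\<^sub>F n in sequentially. norm (char M t - (\<Sum>k\<le>2 * n. (\<i> * t) ^ k / fact k * expectation (\<lambda>x. x ^ k)))
      \<le> 2 * (\<bar>t\<bar> ^ (2 * n) / fact (2 * n) * expectation (\<lambda>x. x ^ (2 * n)))"
          proof (intro always_eventually allI)
      fix n show "norm (char M t - (\<Sum>k\<le>2 * n. (\<i> * t) ^ k / fact k * expectation (\<lambda>x. x ^ k)))
        \<le> 2 * (\<bar>t\<bar> ^ (2 * n) / fact (2 * n) * expectation (\<lambda>x. x ^ (2 * n)))"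
        using char_approx1[of "2 * n" t] int by (simp add: power_even_abs)
    qed
  qed
  from tendsto_diff[OF tendsto_const this, of "char M t"] show ?thesis by simp
qed

lemma moments_determine_law:
  fixes P Q :: "real measure"
  assumes P: "real_distribution P" and Q: "real_distribution Q"
    and int: "\<And>k. integrable P (\<lambda>x. x ^ k)" "\<And>k. integrable Q (\<lambda>x. x ^ k)"
    and eq: "\<And>k. (LINT x|P. x ^ k) = (LINT x|Q. x ^ k)"
    and small: "\<And>t. (\<lambda>n. \<bar>t\<bar> ^ (2 * n) / fact (2 * n) * (LINT x|P. x ^ (2 * n))) \<longlonglongrightarrow> 0"
  shows "P = Q"
proof (rule Levy_uniqueness[OF P Q], rule ext)
  fix t
  note 1 = real_distribution.char_moment_limit[OF P int(1) small[of t]]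
  note 2 = real_distribution.char_moment_limit[OF Q int(2) small[of t, unfolded eq]]
  show "char P t = char Q t" using LIMSEQ_unique[OF 1 2[folded eq]] .
qed

text \<open>The exponential series of \<open>z * x\<close> is dominated by \<open>exp (\<bar>z\<bar> * \<bar>x\<bar>)\<close>, and may be integrated term by
  term.\<close>

lemma (in real_distribution) transform_series:
  fixes z :: complex
  assumes exp_int: "\<And>t. integrable M (\<lambda>x. exp (t * x))"
  shows "(\<lambda>s. of_real (expectation (\<lambda>x. x ^ s) / fact s) * z ^ s) sums (\<integral>x. exp (z * of_real x) \<partial>M)"
    and "integrable M (\<lambda>x. x ^ s)"
proof -
  have abs_int: "integrable M (\<lambda>x. exp (t * \<bar>x\<bar>))" if "0 \<le> t" for t
  proof (rule Bochner_Integration.integrable_bound)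
    show "integrable M (\<lambda>x. exp (t * x) + exp ((- t) * x))" by (intro Bochner_Integration.integrable_add exp_int)
    show "AE x in M. norm (exp (t * \<bar>x\<bar>)) \<le> norm (exp (t * x) + exp ((- t) * x))"
    proof (rule AE_I2)
      fix x :: real
      have "0 < exp (t * x)" "0 < exp ((- t) * x)" "0 < exp (t * \<bar>x\<bar>)" by simp_all
      moreover have "exp (t * \<bar>x\<bar>) = exp (t * x) \<or> exp (t * \<bar>x\<bar>) = exp ((- t) * x)"
        by (cases "0 \<le> x") auto
      ultimately show "norm (exp (t * \<bar>x\<bar>)) \<le> norm (exp (t * x) + exp ((- t) * x))"
        unfolding real_norm_def by linarith
    qed
  qed auto
  have term_le: "t ^ s * \<bar>x\<bar> ^ s / fact s \<le> exp (t * \<bar>x\<bar>)" if "0 \<le> t" for t x :: real and s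
  proof -
    have "(t * \<bar>x\<bar>) ^ s /\<^sub>R fact s \<le> (\<Sum>n. (t * \<bar>x\<bar>) ^ n /\<^sub>R fact n)"
      using sum_le_suminf[OF summable_exp_generic, of "{s}" "t * \<bar>x\<bar>"] that by auto
    then show ?thesis by (simp add: exp_def power_mult_distrib divide_inverse mult.commute)
  qed
  show int: "integrable M (\<lambda>x. x ^ s)" for s
  proof (rule Bochner_Integration.integrable_bound[OF integrable_mult_right[OF abs_int[of 1], of "fact s"]])
    show "AE x in M. norm (x ^ s) \<le> norm (fact s * exp (1 * \<bar>x\<bar>))"
      using term_le[of 1 s] by (intro AE_I2) (simp add: power_abs divide_le_eq mult.commute)
  qed auto
  let ?f = "\<lambda>s x. (z * complex_of_real x) ^ s /\<^sub>R fact s"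
  have f: "?f s = (\<lambda>x. z ^ s / fact s * complex_of_real (x ^ s))" for s
    by (auto simp: power_mult_distrib scaleR_conv_of_real field_simps)
  have f_int: "integrable M (?f s)" for s
    unfolding f by (intro integrable_mult_right integrable_of_real int)
  have f_norm: "norm (?f s x) = (norm z * \<bar>x\<bar>) ^ s /\<^sub>R fact s" for s x
    by (simp add: norm_mult norm_power)
  have "(\<lambda>s. \<integral>x. ?f s x \<partial>M) sums (\<integral>x. (\<Sum>s. ?f s x) \<partial>M)"
  proof (rule sums_integral[OF f_int])
    show "AE x in M. summable (\<lambda>s. norm (?f s x))"
      unfolding f_norm by (intro AE_I2 summable_exp_generic)
    show "summable (\<lambda>s. \<integral>x. norm (?f s x) \<partial>M)"
    proof (rule summableI_nonneg_bounded)
      fix n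
      have "(\<Sum>s<n. \<integral>x. norm (?f s x) \<partial>M) = (\<integral>x. (\<Sum>s<n. norm (?f s x)) \<partial>M)"
        by (intro Bochner_Integration.integral_sum[symmetric] integrable_norm f_int)
      also have "\<dots> \<le> (\<integral>x. exp (norm z * \<bar>x\<bar>) \<partial>M)"
      proof (intro integral_mono Bochner_Integration.integrable_sum integrable_norm f_int abs_int)
        fix x show "(\<Sum>s<n. norm (?f s x)) \<le> exp (norm z * \<bar>x\<bar>)"
          unfolding f_norm exp_def by (intro sum_le_suminf summable_exp_generic) auto
      qed simp
      finally show "(\<Sum>s<n. \<integral>x. norm (?f s x) \<partial>M) \<le> (\<integral>x. exp (norm z * \<bar>x\<bar>) \<partial>M)" .
    qed (simp add: integral_nonneg)
  qed
  moreover have "(\<integral>x. ?f s x \<partial>M) = of_real (expectation (\<lambda>x. x ^ s) / fact s) * z ^ s" for s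
    using integral_complex_of_real[of M "\<lambda>x. x ^ s"] unfolding f
    by (simp del: of_real_power integral_complex_of_real)
  ultimately show "(\<lambda>s. of_real (expectation (\<lambda>x. x ^ s) / fact s) * z ^ s) sums (\<integral>x. exp (z * of_real x) \<partial>M)"
    by (simp add: exp_def)
qed

text \<open>Both sides of the identity for the characteristic function are restrictions of entire functions to
  the imaginary axis. The zeros of their difference accumulate at \<open>0\<close>, so all its Taylor
  coefficients vanish.\<close>

lemma (in real_distribution) moments_from_char:
  assumes exp_int: "\<And>t. integrable M (\<lambda>x. exp (t * x))"
    and series: "\<And>z. (\<lambda>s. a s * z ^ s) sums h z"
    and char: "\<And>t. char M t = h (\<i> * of_real t)" and s: "1 \<le> s"
  shows "a s = of_real (expectation (\<lambda>x. x ^ s) / fact s)"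
proof (rule ccontr)
  assume "a s \<noteq> of_real (expectation (\<lambda>x. x ^ s) / fact s)"
  let ?m = "\<lambda>s. complex_of_real (expectation (\<lambda>x. x ^ s) / fact s)"
  let ?g = "\<lambda>z. (\<integral>x. exp (z * of_real x) \<partial>M) - h z"
  have zero: "?g (\<i> * of_real t) = 0" for t
    by (simp add: char[symmetric] char_def mult.assoc)
  have "(\<lambda>s. (?m s - a s) * z ^ s) sums ?g z" for z
    using sums_diff[OF transform_series(1)[OF exp_int, of z] series[of z]] by (simp add: algebra_simps)
  then obtain r where r: "0 < r" "\<And>z. z \<in> cball 0 r - {0} \<Longrightarrow> ?g z \<noteq> 0"
    using powser_0_nonzero[of 1 0 "\<lambda>s. ?m s - a s" ?g s] zero[of 0] s \<open>a s \<noteq> _\<close> by auto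
  then show False using zero[of r] r(2)[of "\<i> * of_real r"] by (simp add: norm_mult)
qed

text \<open>\<^const>\<open>eta\<close> is a definite description. The law \<open>P\<close> has the moments in question; its transform
  converges everywhere, so that \<open>t ^ (2 * n) / (2 * n)!\<close> times the moment of order \<open>2 * n\<close> tends to
  \<open>0\<close>, and any other law with these moments coincides with \<open>P\<close>.\<close>

lemma eta_unique:
  fixes P :: "real measure"
  assumes P: "real_distribution P" and exp_int: "\<And>t. integrable P (\<lambda>x. exp (t * x))"
    and series: "\<And>z. (\<lambda>m. fps_nth (cumulant_fps (cumulant \<alpha> c)) m * z ^ m) sums k z"
    and char: "\<And>t. char P t = exp (k (\<i> * of_real t))"
  shows "eta \<alpha> c = P"
proof -
  interpret P: real_distribution P by fact
  let ?F = "fps_exp 1 oo cumulant_fps (cumulant \<alpha> c)"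
  have F: "(\<lambda>s. fps_nth ?F s * z ^ s) sums exp (k z)" for z
    by (rule exp_compose_sums[OF _ series]) (simp add: cumulant_fps_def)
  have mom: "(LINT x|P. x ^ s) = eta_moment \<alpha> c s" if "1 \<le> s" for s
    using P.moments_from_char[OF exp_int F char that] eta_moment_eq_fps[OF that, of \<alpha> c]
    by (simp del: of_real_divide)
  have has: "has_eta_moments \<alpha> c P"
    unfolding has_eta_moments_def using mom P.transform_series(2)[OF exp_int] P.prob_space_axioms by simp
  have small: "(\<lambda>n. \<bar>t\<bar> ^ (2 * n) / fact (2 * n) * (LINT x|P. x ^ (2 * n))) \<longlonglongrightarrow> 0" for t
  proof -
    let ?a = "\<lambda>s. complex_of_real (P.expectation (\<lambda>x. x ^ s) / fact s) * (of_real t) ^ s"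
    have "?a \<longlonglongrightarrow> 0"
      using P.transform_series(1)[OF exp_int, of "of_real t"] by (intro summable_LIMSEQ_zero) (rule sums_summable)
    then have "(\<lambda>n. norm (?a (2 * n))) \<longlonglongrightarrow> 0"
      by (intro tendsto_norm_zero) (rule LIMSEQ_subseq_LIMSEQ[unfolded comp_def], auto simp: strict_mono_def)
    moreover have "norm (?a (2 * n)) = \<bar>t\<bar> ^ (2 * n) / fact (2 * n) * (LINT x|P. x ^ (2 * n))" for n
      by (simp add: norm_mult norm_power norm_divide integral_nonneg power_even_abs)
    ultimately show ?thesis by simp
  qed
  show ?thesis unfolding eta_def
  proof (rule the_equality[where P="has_eta_moments \<alpha> c", OF has])
    fix Q assume Q: "has_eta_moments \<alpha> c Q"
    then have "real_distribution Q"
      by (intro real_distribution.intro real_distribution_axioms.intro) (auto simp: has_eta_moments_def)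
    then interpret Q: real_distribution Q .
    have int: "integrable Q (\<lambda>x. x ^ k)" for k
      using Q by (cases "k = 0") (auto simp: has_eta_moments_def)
    have "P.prob UNIV = 1" "Q.prob UNIV = 1"
      using P.prob_space Q.prob_space by simp_all
    then have "(LINT x|P. x ^ k) = (LINT x|Q. x ^ k)" for k
      using Q mom by (cases "k = 0") (auto simp: has_eta_moments_def)
    then show "Q = P"
      by (intro moments_determine_law[symmetric, OF P Q.real_distribution_axioms] int small
          P.transform_series(2)[OF exp_int])
  qed
qed

section \<open>The moments of the intensity measure\<close>

definition beta_moment :: "real \<Rightarrow> real \<Rightarrow> nat \<Rightarrow> real" where
  "beta_moment a b k = Beta (a + real k) b / Beta a b"

lemma beta_law_measurable_cong [simp, measurable_cong]: "sets (beta_law a b) = sets borel"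
  by (simp add: beta_law_def)

text \<open>The factor \<open>x ^ k\<close> shifts the first parameter of the Beta integral by \<open>k\<close>.\<close>

lemma beta_law_moment:
  assumes "0 < a" "0 < b"
  shows "(\<integral>\<^sup>+x. ennreal (x ^ k) * indicator {0<..<1} x \<partial>beta_law a b) = ennreal (beta_moment a b k)"
proof -
  let ?f = "\<lambda>x::real. indicator {0<..<1} x * (x powr (a + real k - 1) * (1 - x) powr (b - 1) / Beta a b)"
  have B: "0 < Beta a b" using assms by (simp add: Beta_def Gamma_real_pos)
  have "((\<lambda>t. t powr (a + real k - 1) * (1 - t) powr (b - 1)) has_integral Beta (a + real k) b) {0<..<1}"
    using has_integral_Beta_real[of "a + real k" b] assms by (simp add: has_integral_Icc_iff_Ioo)
  then have "((\<lambda>t. t powr (a + real k - 1) * (1 - t) powr (b - 1) / Beta a b) has_integral beta_moment a b k) {0<..<1}"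
    unfolding beta_moment_def by (rule has_integral_divide)
  then have "((\<lambda>t. if t \<in> {0<..<1} then t powr (a + real k - 1) * (1 - t) powr (b - 1) / Beta a b else 0)
      has_integral beta_moment a b k) UNIV"
    by (simp only: has_integral_restrict_UNIV)
  then have "(?f has_integral beta_moment a b k) UNIV"
    by (rule has_integral_eq[rotated]) (auto simp: indicator_def)
  then have "(\<integral>\<^sup>+x. ennreal (?f x) \<partial>lborel) = ennreal (beta_moment a b k)"
    using B by (intro nn_integral_has_integral_lborel) (auto intro!: mult_nonneg_nonneg divide_nonneg_nonneg)
  moreover have "(\<integral>\<^sup>+x. ennreal (x ^ k) * indicator {0<..<1} x \<partial>beta_law a b) = (\<integral>\<^sup>+x. ennreal (?f x) \<partial>lborel)"
    unfolding beta_law_def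
  proof (subst nn_integral_density, simp, simp, rule nn_integral_cong)
    fix x :: real
    have "x powr (a - 1) * x ^ k = x powr (a + real k - 1)" if "0 < x"
      using that by (simp add: powr_realpow[symmetric] powr_add[symmetric] algebra_simps)
    then show "ennreal (indicator {0<..<1} x * (x powr (a - 1) * (1 - x) powr (b - 1) / Beta a b)) *
        (ennreal (x ^ k) * indicator {0<..<1} x) = ennreal (?f x)"
      using B by (auto simp: indicator_def ennreal_mult[symmetric] intro!: arg_cong[where f=ennreal])
  qed
  ultimately show ?thesis by simp
qed

lemma beta_law_AE: "AE x in beta_law a b. x \<in> {0<..<1}"
  unfolding beta_law_def by (subst AE_density) (auto simp: indicator_def)

lemma prob_space_beta_law:
  assumes "0 < a" "0 < b" shows "prob_space (beta_law a b)"
proof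
  have "emeasure (beta_law a b) (space (beta_law a b)) = (\<integral>\<^sup>+x. 1 \<partial>beta_law a b)" by simp
  also have "\<dots> = (\<integral>\<^sup>+x. ennreal (x ^ 0) * indicator {0<..<1} x \<partial>beta_law a b)"
    by (rule nn_integral_cong_AE) (use beta_law_AE[of a b] in \<open>eventually_elim, simp\<close>)
  also have "\<dots> = 1"
    unfolding beta_law_moment[OF assms] using assms
    by (simp add: beta_moment_def Beta_def Gamma_real_pos less_imp_neq[symmetric])
  finally show "emeasure (beta_law a b) (space (beta_law a b)) = 1" .
qed

text \<open>By independence, a function whose value at \<open>2 * x * y\<close> is a multiple of \<open>x ^ k * y ^ k\<close> integrates to the
  square of a Beta moment. The function \<open>h\<close> is general so that it can include the density of the
  intensity with respect to the law of twice the product.\<close>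

lemma beta_product_moment:
  assumes a: "0 < a" "0 < b" and C: "0 \<le> C" and h [measurable]: "h \<in> borel_measurable borel"
    and h_eq: "\<And>x y. x \<in> {0<..<1} \<Longrightarrow> y \<in> {0<..<1} \<Longrightarrow> h (2 * (x * y)) = ennreal (C * x ^ k * y ^ k)"
  shows "(\<integral>\<^sup>+x. h x \<partial>twice_beta_product_law a b) = ennreal (C * (beta_moment a b k)\<^sup>2)"
proof -
  let ?B = "beta_law a b"
  interpret B: prob_space ?B by (rule prob_space_beta_law[OF a])
  have pos: "0 \<le> beta_moment a b k"
    using a by (simp add: beta_moment_def Beta_def Gamma_real_pos less_imp_le)
  have "(\<integral>\<^sup>+x. h x \<partial>twice_beta_product_law a b) = (\<integral>\<^sup>+p. h (2 * (fst p * snd p)) \<partial>(?B \<Otimes>\<^sub>M ?B))"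
    unfolding twice_beta_product_law_def by (subst nn_integral_distr) (auto simp: split_beta')
  also have "\<dots> = (\<integral>\<^sup>+x. \<integral>\<^sup>+y. h (2 * (x * y)) \<partial>?B \<partial>?B)"
    by (subst B.nn_integral_fst[symmetric]) auto
  also have "\<dots> = (\<integral>\<^sup>+x. \<integral>\<^sup>+y. ennreal C * (ennreal (x ^ k) * indicator {0<..<1} x) * (ennreal (y ^ k) * indicator {0<..<1} y) \<partial>?B \<partial>?B)"
  proof (rule nn_integral_cong_AE, use beta_law_AE[of a b] in eventually_elim)
    case (elim x)
    show ?case
    proof (rule nn_integral_cong_AE, use beta_law_AE[of a b] in eventually_elim)
      case (elim y)
      then show ?case using \<open>x \<in> {0<..<1}\<close> C
        by (simp only: h_eq) (simp add: ennreal_mult)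
    qed
  qed
  also have "\<dots> = (\<integral>\<^sup>+x. ennreal C * (ennreal (x ^ k) * indicator {0<..<1} x) * ennreal (beta_moment a b k) \<partial>?B)"
    by (subst nn_integral_cmult) (auto simp: beta_law_moment[OF a])
  also have "\<dots> = ennreal C * ennreal (beta_moment a b k) * ennreal (beta_moment a b k)"
    by (subst nn_integral_multc, simp, subst nn_integral_cmult) (auto simp: beta_law_moment[OF a])
  also have "\<dots> = ennreal (C * (beta_moment a b k)\<^sup>2)"
    using C pos by (simp add: ennreal_mult power2_eq_square mult.assoc)
  finally show ?thesis .
qed

lemma sets_twice_beta [simp, measurable_cong]: "sets (twice_beta_product_law a b) = sets borel"
  by (simp add: twice_beta_product_law_def)

lemma sets_nu_measure: "sets (nu \<alpha> c) = sets (restrict_space borel {0<..2})"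
  unfolding nu_def by (auto simp: sets_restrict_space)

lemma nn_integral_nu:
  assumes [measurable]: "f \<in> borel_measurable borel"
  shows "(\<integral>\<^sup>+x. f x \<partial>nu \<alpha> c) =
    (if \<alpha> < 2 then \<integral>\<^sup>+x. ennreal (c\<^sup>2 / x) * (f x * indicator {0<..2} x) \<partial>twice_beta_product_law (1 - \<alpha> / 2) (\<alpha> / 2)
     else \<integral>\<^sup>+x. ennreal (2 * c\<^sup>2 * (c_coeff \<alpha> 2)\<^sup>2 / x\<^sup>2) * (f x * indicator {0<..2} x)
        \<partial>twice_beta_product_law (2 - \<alpha> / 2) (\<alpha> / 2))"
  unfolding nu_def by (auto simp: nn_integral_restrict_space nn_integral_density)

lemma c_coeff_beta:
  assumes "0 < \<alpha>" "\<alpha> < 2" "1 \<le> m"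
  shows "beta_moment (1 - \<alpha> / 2) (\<alpha> / 2) (m - 1) = c_coeff \<alpha> m"
proof -
  have e: "1 - \<alpha> / 2 + real (m - 1) = real m - \<alpha> / 2" using assms by (simp add: of_nat_diff)
  have "Gamma (1 - \<alpha> / 2) \<noteq> 0" "Gamma (\<alpha> / 2) \<noteq> 0"
    using assms by (auto intro!: less_imp_neq[OF Gamma_real_pos, symmetric])
  then show ?thesis using assms
    by (simp add: beta_moment_def e Beta_def c_coeff_def)
qed

lemma c_coeff_beta':
  assumes "2 \<le> \<alpha>" "\<alpha> < 4" "2 \<le> m"
  shows "c_coeff \<alpha> 2 * beta_moment (2 - \<alpha> / 2) (\<alpha> / 2) (m - 2) = c_coeff \<alpha> m"
proof -
  have e: "2 - \<alpha> / 2 + real (m - 2) = real m - \<alpha> / 2" using assms by (simp add: of_nat_diff)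
  have G: "Gamma (2::real) = 1" using Gamma_fact[of 1, where 'a=real] by simp
  have "Gamma (2 - \<alpha> / 2) \<noteq> 0" "Gamma (\<alpha> / 2) \<noteq> 0"
    using assms by (auto intro!: less_imp_neq[OF Gamma_real_pos, symmetric])
  then show ?thesis using assms
    by (simp add: beta_moment_def e Beta_def c_coeff_def G)
qed

text \<open>The density of \<open>nu \<alpha> c\<close> lowers the degree \<open>m\<close> by \<open>1\<close> or by \<open>2\<close>; what remains is a moment of twice a
  product of two independent Beta variables, and the factor \<open>2\<close> of the variable contributes the power of two. The
  case \<open>m = 1\<close>, in which the integral is finite only for \<open>\<alpha> < 2\<close>, is the centring \<open>c\<^sup>2\<close>.\<close>

lemma nu_moment:
  assumes \<alpha>: "0 < \<alpha>" "\<alpha> < 4" and m: "2 \<le> m \<or> \<alpha> < 2 \<and> 1 \<le> m"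
  shows "(\<integral>\<^sup>+x. ennreal (x ^ m) \<partial>nu \<alpha> c) = ennreal (c\<^sup>2 * 2 ^ (m - 1) * (c_coeff \<alpha> m)\<^sup>2)"
proof (cases "\<alpha> < 2")
  case True
  then have m: "1 \<le> m" using m by auto
  have "(\<integral>\<^sup>+x. ennreal (c\<^sup>2 / x) * (ennreal (x ^ m) * indicator {0<..2} x) \<partial>twice_beta_product_law (1 - \<alpha> / 2) (\<alpha> / 2))
    = ennreal (c\<^sup>2 * 2 ^ (m - 1) * (beta_moment (1 - \<alpha> / 2) (\<alpha> / 2) (m - 1))\<^sup>2)"
  proof (rule beta_product_moment)
    fix x y :: real assume xy: "x \<in> {0<..<1}" "y \<in> {0<..<1}"
    have "x * y < 1" using xy mult_strict_mono[of x 1 y 1] by simp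
    have p: "0 < 2 * (x * y)" using xy by simp
    have "(2 * (x * y)) ^ m = (2 * (x * y)) * (2 * (x * y)) ^ (m - 1)"
      using m by (metis One_nat_def Suc_pred less_eq_Suc_le power_Suc)
    then have "c\<^sup>2 / (2 * (x * y)) * (2 * (x * y)) ^ m = c\<^sup>2 * 2 ^ (m - 1) * x ^ (m - 1) * y ^ (m - 1)"
      using xy by (simp add: power_mult_distrib)
    then show "ennreal (c\<^sup>2 / (2 * (x * y))) * (ennreal ((2 * (x * y)) ^ m) * indicator {0<..2} (2 * (x * y)))
      = ennreal (c\<^sup>2 * 2 ^ (m - 1) * x ^ (m - 1) * y ^ (m - 1))"
      using p \<open>x * y < 1\<close> by (simp add: ennreal_mult[symmetric] del: zero_less_mult_iff)
  qed (use True \<alpha> in auto)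
  then show ?thesis using True c_coeff_beta[OF \<alpha>(1) True m] by (simp add: nn_integral_nu)
next
  case False
  then have m: "2 \<le> m" using m by auto
  have "(\<integral>\<^sup>+x. ennreal (2 * c\<^sup>2 * (c_coeff \<alpha> 2)\<^sup>2 / x\<^sup>2) * (ennreal (x ^ m) * indicator {0<..2} x) \<partial>twice_beta_product_law (2 - \<alpha> / 2) (\<alpha> / 2))
    = ennreal (2 * c\<^sup>2 * (c_coeff \<alpha> 2)\<^sup>2 * 2 ^ (m - 2) * (beta_moment (2 - \<alpha> / 2) (\<alpha> / 2) (m - 2))\<^sup>2)"
  proof (rule beta_product_moment)
    fix x y :: real assume xy: "x \<in> {0<..<1}" "y \<in> {0<..<1}"
    have "x * y < 1" using xy mult_strict_mono[of x 1 y 1] by simp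
    have p: "0 < 2 * (x * y)" using xy by simp
    have "(2 * (x * y)) ^ m = (2 * (x * y))\<^sup>2 * (2 * (x * y)) ^ (m - 2)"
      using m by (metis le_add_diff_inverse power_add)
    then have "2 * c\<^sup>2 * (c_coeff \<alpha> 2)\<^sup>2 / (2 * (x * y))\<^sup>2 * (2 * (x * y)) ^ m
      = 2 * c\<^sup>2 * (c_coeff \<alpha> 2)\<^sup>2 * 2 ^ (m - 2) * x ^ (m - 2) * y ^ (m - 2)"
      using xy by (simp add: power_mult_distrib)
    then show "ennreal (2 * c\<^sup>2 * (c_coeff \<alpha> 2)\<^sup>2 / (2 * (x * y))\<^sup>2) * (ennreal ((2 * (x * y)) ^ m) * indicator {0<..2} (2 * (x * y)))
      = ennreal (2 * c\<^sup>2 * (c_coeff \<alpha> 2)\<^sup>2 * 2 ^ (m - 2) * x ^ (m - 2) * y ^ (m - 2))"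
      using p \<open>x * y < 1\<close> by (simp add: ennreal_mult[symmetric] del: zero_less_mult_iff)
  qed (use False \<alpha> in auto)
  also have "2 * c\<^sup>2 * (c_coeff \<alpha> 2)\<^sup>2 * 2 ^ (m - 2) * (beta_moment (2 - \<alpha> / 2) (\<alpha> / 2) (m - 2))\<^sup>2
    = c\<^sup>2 * (2 * 2 ^ (m - 2)) * (c_coeff \<alpha> 2 * beta_moment (2 - \<alpha> / 2) (\<alpha> / 2) (m - 2))\<^sup>2"
    by (simp add: power_mult_distrib)
  also have "2 * 2 ^ (m - 2) = (2::real) ^ (m - 1)"
    using m by (metis Suc_1 Suc_diff_Suc Suc_le_lessD power_Suc)
  finally show ?thesis using False \<alpha> m by (simp add: nn_integral_nu c_coeff_beta')
qed

lemma nu_power_integral: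
  assumes \<alpha>: "0 < \<alpha>" "\<alpha> < 4" and m: "2 \<le> m \<or> \<alpha> < 2 \<and> 1 \<le> m"
  shows "integrable (nu \<alpha> c) (\<lambda>x. x ^ m)" "(\<integral>x. x ^ m \<partial>nu \<alpha> c) = cumulant \<alpha> c m"
proof -
  have meas: "(\<lambda>x. x ^ m) \<in> borel_measurable (nu \<alpha> c)"
    by (simp add: measurable_cong_sets[OF sets_nu_measure refl] measurable_restrict_space1)
  have sp: "space (nu \<alpha> c) = {0<..2}"
    using sets_eq_imp_space_eq[OF sets_nu_measure] by (simp add: space_restrict_space)
  have nn: "AE x in nu \<alpha> c. 0 \<le> x ^ m" by (rule AE_I2) (simp add: sp)
  have nneg: "0 \<le> cumulant \<alpha> c m" by (simp add: cumulant_def)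
  have eq: "(\<integral>\<^sup>+x. ennreal (x ^ m) \<partial>nu \<alpha> c) = ennreal (cumulant \<alpha> c m)"
    unfolding cumulant_def by (rule nu_moment[OF \<alpha> m])
  show "integrable (nu \<alpha> c) (\<lambda>x. x ^ m)"
    by (rule integrableI_nonneg[OF meas nn]) (simp add: eq)
  show "(\<integral>x. x ^ m \<partial>nu \<alpha> c) = cumulant \<alpha> c m"
    using nneg by (simp add: integral_eq_nn_integral[OF meas nn] eq)
qed

section \<open>The law of the compensated sum of the points\<close>

context compensated_jumps
begin

text \<open>All data enter through the cumulants, which are the moments of \<open>\<nu>\<close> of order at least \<open>2\<close>.\<close>

lemma compensated_law:
  assumes X: "has_compensated_integral M \<nu> N (\<lambda>x. x) X"
    and cumulants: "\<And>m. 2 \<le> m \<Longrightarrow> (\<integral>x. x ^ m \<partial>\<nu>) = cumulant \<alpha> c m"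
  shows "distr M borel X = eta \<alpha> c"
proof (rule eta_unique[symmetric])
  have [measurable]: "X \<in> borel_measurable M" by (rule compensated_measurable[OF X])
  show "real_distribution (distr M borel X)" by (rule real_distribution_distr) simp
  show "integrable (distr M borel X) (\<lambda>x. exp (t * x))" for t
    using compensated_exp_integrable[OF X] by (subst integrable_distr_eq) auto
  show "(\<lambda>m. fps_nth (cumulant_fps (cumulant \<alpha> c)) m * z ^ m) sums
      (\<integral>x. exp (z * of_real x) - 1 - z * of_real x \<partial>\<nu>)" for z
    using cumulant_series[of z] cumulants by (simp add: cumulant_fps_def cong: if_cong)
  show "char (distr M borel X) t =
    exp (\<integral>x. exp (\<i> * of_real t * of_real x) - 1 - \<i> * of_real t * of_real x \<partial>\<nu>)" for t
    by (rule compensated_char[OF X])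
qed

text \<open>If the intensity has a finite mean, the sum of the points is integrable by Campbell's formula, and
  truncated sums and truncated means converge separately, by dominated convergence.\<close>

lemma compensated_sum:
  assumes int: "integrable \<nu> (\<lambda>x. x)"
    and \<xi> [measurable]: "\<And>i. \<xi> i \<in> M \<rightarrow>\<^sub>M restrict_space borel {0<..2}"
    and N_sum: "\<And>\<omega>. \<omega> \<in> space M \<Longrightarrow> N \<omega> = dirac_sum (restrict_space borel {0<..2}) (\<lambda>i. \<xi> i \<omega>)"
  shows "AE \<omega> in M. summable (\<lambda>i. \<xi> i \<omega>)"
    and "has_compensated_integral M \<nu> N (\<lambda>x. x) (\<lambda>\<omega>. (\<Sum>i. \<xi> i \<omega>) - (\<integral>x. x \<partial>\<nu>))"
proof -
  let ?S = "restrict_space borel {0<..2::real}"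
  have \<xi>_pos: "0 < \<xi> i \<omega>" if "\<omega> \<in> space M" for i \<omega>
    using measurable_space[OF \<xi> that, of i] by (simp add: space_restrict_space)
  have \<xi>_meas [measurable]: "\<xi> i \<in> borel_measurable M" for i
    using \<xi>[of i] by (simp add: measurable_restrict_space2_iff)
  have id_S: "(\<lambda>x. x) \<in> borel_measurable ?S" by (rule measurable_restrict_space1) simp
  have idx: "(\<lambda>i. \<xi> i \<omega>) \<in> count_space UNIV \<rightarrow>\<^sub>M ?S" if "\<omega> \<in> space M" for \<omega>
    using measurable_space[OF \<xi> that] by simp
  have nn: "(\<integral>\<^sup>+x. ennreal x \<partial>N \<omega>) = (\<Sum>i. ennreal (\<xi> i \<omega>))" if "\<omega> \<in> space M" for \<omega>
    using id_S by (simp add: N_sum that dirac_sum_def nn_integral_distr[OF idx[OF that]] nn_integral_count_space_nat)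
  have "(\<integral>\<^sup>+\<omega>. (\<Sum>i. ennreal (\<xi> i \<omega>)) \<partial>M) = (\<integral>\<^sup>+\<omega>. \<integral>\<^sup>+x. ennreal x \<partial>N \<omega> \<partial>M)"
    by (intro nn_integral_cong) (simp add: nn)
  also have "\<dots> = (\<integral>\<^sup>+x. ennreal x \<partial>\<nu>)" by (rule campbell(2)) measurable
  also have "\<dots> = (\<integral>\<^sup>+x. ennreal (norm x) \<partial>\<nu>)"
    by (rule nn_integral_cong) (simp add: space_nu)
  also have "\<dots> < \<infinity>" using int by (simp add: integrable_iff_bounded)
  finally have "(\<integral>\<^sup>+\<omega>. (\<Sum>i. ennreal (\<xi> i \<omega>)) \<partial>M) \<noteq> \<infinity>" by simp
  then have fin: "AE \<omega> in M. (\<Sum>i. ennreal (\<xi> i \<omega>)) \<noteq> \<infinity>"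
    by (intro nn_integral_PInf_AE) measurable
  show summ: "AE \<omega> in M. summable (\<lambda>i. \<xi> i \<omega>)"
    using fin AE_space
  proof eventually_elim
    case (elim \<omega>)
    then show ?case using \<xi>_pos[OF elim(2)] by (intro summable_suminf_not_top) (auto simp: less_imp_le)
  qed
  let ?X = "\<lambda>\<omega>. (\<Sum>i. \<xi> i \<omega>) - (\<integral>x. x \<partial>\<nu>)"
  let ?e = "\<lambda>n. 1 / real (Suc n)"
  have e: "0 < ?e n" "?e \<longlonglongrightarrow> 0" for n
    using LIMSEQ_inverse_real_of_nat by (auto simp: divide_inverse)
  have lim: "AE \<omega> in M. (\<lambda>n. trunc (?e n) \<omega>) \<longlonglongrightarrow> ?X \<omega>"
    using summ AE_space
  proof eventually_elim
    case (elim \<omega>)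
    have "integrable (count_space UNIV) (\<lambda>i. \<xi> i \<omega>)"
      using elim(1) \<xi>_pos[OF elim(2)] by (simp add: integrable_count_space_nat_iff less_imp_le)
    then have i: "integrable (N \<omega>) (\<lambda>x. x)" and I: "(\<integral>x. x \<partial>N \<omega>) = (\<Sum>i. \<xi> i \<omega>)"
      using id_S unfolding N_sum[OF elim(2)] dirac_sum_def
      by (simp_all add: integrable_distr_eq[OF idx[OF elim(2)]] integral_distr[OF idx[OF elim(2)]] integral_count_space_nat)
    show ?case
      using tendsto_diff[OF band_exhausts[OF e sets_N[OF elim(2)] i] band_exhausts[OF e refl int]]
      by (simp add: trunc_def compensated_band_def I)
  qed
  show "has_compensated_integral M \<nu> N (\<lambda>x. x) ?X"
    by (rule trunc_limit_compensated[OF e _ lim]) measurable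
qed

end

theorem theorem3p9:
  fixes M :: "'w measure"
    and \<alpha> c\<delta> :: real
    and \<xi> :: "nat \<Rightarrow> 'w \<Rightarrow> real"
    and N :: "'w \<Rightarrow> real measure"
  assumes "prob_space M"
    and "0 < \<alpha>" and "\<alpha> < 3" and "0 < c\<delta>"
    and "\<And>i. \<xi> i \<in> M \<rightarrow>\<^sub>M restrict_space borel {0<..2}"
    and "\<And>\<omega>. \<omega> \<in> space M \<Longrightarrow> N \<omega> = dirac_sum (restrict_space borel {0<..2}) (\<lambda>i. \<xi> i \<omega>)"
    and "poisson_point_process M (nu \<alpha> c\<delta>) N"
  shows "(\<exists>X. has_compensated_integral M (nu \<alpha> c\<delta>) N (\<lambda>x. x) X)
    \<and> (\<forall>X. has_compensated_integral M (nu \<alpha> c\<delta>) N (\<lambda>x. x) X \<longrightarrow> distr M borel X = eta \<alpha> c\<delta>)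
    \<and> (\<alpha> < 2 \<longrightarrow>
         (AE \<omega> in M. summable (\<lambda>i. \<xi> i \<omega>))
         \<and> distr M borel (\<lambda>\<omega>. (\<Sum>i. \<xi> i \<omega>) - c\<delta>\<^sup>2) = eta \<alpha> c\<delta>
         \<and> has_compensated_integral M (nu \<alpha> c\<delta>) N (\<lambda>x. x) (\<lambda>\<omega>. (\<Sum>i. \<xi> i \<omega>) - c\<delta>\<^sup>2))"
proof -
  let ?\<nu> = "nu \<alpha> c\<delta>"
  have \<alpha>: "0 < \<alpha>" "\<alpha> < 4" using assms by simp_all
  interpret compensated_jumps M ?\<nu> N
    using assms(1,7) nu_power_integral(1)[OF \<alpha>, of 2 c\<delta>]
    by (intro compensated_jumps.intro poisson_process.intro poisson_process_axioms.intro
        compensated_jumps_axioms.intro sets_nu_measure) auto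
  have law: "distr M borel X = eta \<alpha> c\<delta>" if "has_compensated_integral M ?\<nu> N (\<lambda>x. x) X" for X
    by (rule compensated_law[OF that]) (simp add: nu_power_integral(2)[OF \<alpha>])
  have "(AE \<omega> in M. summable (\<lambda>i. \<xi> i \<omega>))
      \<and> has_compensated_integral M ?\<nu> N (\<lambda>x. x) (\<lambda>\<omega>. (\<Sum>i. \<xi> i \<omega>) - c\<delta>\<^sup>2)" if "\<alpha> < 2"
  proof -
    have "integrable ?\<nu> (\<lambda>x. x)"
      using nu_power_integral(1)[OF \<alpha>, of 1 c\<delta>] that by simp
    moreover have "c_coeff \<alpha> 1 = 1"
      using that less_imp_neq[OF Gamma_real_pos[of "1 - \<alpha> / 2"], symmetric]
      by (simp add: c_coeff_def)
    then have "(\<integral>x. x \<partial>?\<nu>) = c\<delta>\<^sup>2"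
      using nu_power_integral(2)[OF \<alpha>, of 1 c\<delta>] that by (simp add: cumulant_def)
    ultimately show ?thesis
      using compensated_sum[OF _ assms(5,6)] by simp
  qed
  with law compensated_exists show ?thesis by blast
qed

end
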